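(* Let $\mathcal M$ be a three-dimensional non-para-Sasakian paracontact metric $(\kappa,\mu)$-space with structure $(\phi,\xi,\eta,g)$, and let $p$ be a point of $\mathcal M$. Assume there is a local vector field $X$, defined on a neighborhood of $p$, such that $\phi X = X$ and $hX\neq 0$ on this neighborhood. Then on a neighborhood of $p$ there are a local Artin frame $(\xi,E_1,E_2)$, a function $b$ and a constant $\epsilon=\pm1$ such that $$\nabla_\xi\xi=0,\quad \nabla_\xi E_1=-\tfrac{\mu}{2}E_1,\quad \nabla_\xi E_2=\tfrac{\mu}{2}E_2,$$ $$\nabla_{E_1}\xi=-E_1-\epsilon E_2,\quad \nabla_{E_1}E_1=bE_1+\epsilon\xi,\quad \nabla_{E_1}E_2=-bE_2+\xi,$$ $$\nabla_{E_2}\xi=\epsilon(\kappa+1)E_1+E_2,\quad \nabla_{E_2}E_1=-\xi,\quad \nabla_{E_2}E_2=-\epsilon(\kappa+1)\xi.$$ If $\kappa\neq-1$, the function $b$ vanishes.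
   Context: All manifolds, tensor fields and functions are smooth; manifolds are connected and without boundary. An almost paracontact metric structure on a $3$-dimensional manifold is a quadruple $(\phi,\xi,\eta,g)$: a $(1,1)$-tensor field $\phi$, a vector field $\xi$, a $1$-form $\eta$ and a pseudo-Riemannian metric $g$ of signature $(2,1)$ with $\phi^2=Id-\eta\otimes\xi$, $\eta(\xi)=1$, $g(\phi X,\phi Y)=-g(X,Y)+\eta(X)\eta(Y)$. The fundamental form is $\Phi(X,Y)=g(X,\phi Y)$. The structure is paracontact metric if $d\eta=\Phi$, where $2\,d\eta(X,Y)=X\eta(Y)-Y\eta(X)-\eta([X,Y])$. It is normal if $N_\phi-2\,d\eta\otimes\xi=0$, where $N_\phi(X,Y)=\phi^2[X,Y]+[\phi X,\phi Y]-\phi([\phi X,Y]+[X,\phi Y])$; para-Sasakian means paracontact metric and normal. Put $h=\frac12\mathcal L_\xi\phi$. Let $\nabla$ be the Levi-Civita connection of $g$ and $R_{XY}Z=[\nabla_X,\nabla_Y]Z-\nabla_{[X,Y]}Z$. The manifold is a $(\kappa,\mu)$-space, $\kappa,\mu\in\mathbb R$, if $R_{XY}\xi=\kappa(\eta(Y)X-\eta(X)Y)+\mu(\eta(Y)hX-\eta(X)hY)$ for all $X,Y$. A local Artin frame is a local frame $(\xi,E_1,E_2)$ with $\phi E_1=E_1$, $\phi E_2=-E_2$, $g(\xi,E_1)=g(\xi,E_2)=0$, $g(E_1,E_2)=1$ (then $g(E_1,E_1)=g(E_2,E_2)=0$). *)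

theory Defs
  imports "HOL-Analysis.Analysis" "HOL-Library.Function_Algebras"
begin

primrec Ck_on :: "nat \<Rightarrow> 'a::real_normed_vector set \<Rightarrow> ('a \<Rightarrow> 'b::real_normed_vector) \<Rightarrow> bool" where
  "Ck_on 0 S f \<longleftrightarrow> continuous_on S f"
| "Ck_on (Suc k) S f \<longleftrightarrow> (\<forall>x\<in>S. f differentiable at x) \<and>
     (\<forall>v. Ck_on k S (\<lambda>x. frechet_derivative f (at x) v))"

text \<open>Only used for open \<open>S\<close> in a finite-dimensional space, where this is the usual notion.\<close>

definition smooth_on :: "'a::real_normed_vector set \<Rightarrow> ('a \<Rightarrow> 'b::real_normed_vector) \<Rightarrow> bool" where
  "smooth_on S f \<longleftrightarrow> (\<forall>k. Ck_on k S f)"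

text \<open>
  The manifold is the whole type \<open>'m\<close>. A chart is a pair \<open>(U, c)\<close> in which only the
  values of \<open>c\<close> on \<open>U\<close> matter; its inverse is \<open>inv_into U c\<close>. The Hausdorff and
  second-countability axioms are left to the sort of \<open>'m\<close>.
\<close>

type_synonym 'm chart = "'m set \<times> ('m \<Rightarrow> real ^ 3)"
type_synonym 'm atlas = "'m chart set"

definition smooth_atlas :: "'m::topological_space atlas \<Rightarrow> bool" where
  "smooth_atlas A \<longleftrightarrow>
     (\<forall>(U, c)\<in>A. open U \<and> open (c ` U) \<and> homeomorphism U (c ` U) c (inv_into U c)) \<and>
     (\<Union>(U, c)\<in>A. U) = UNIV \<and>
     (\<forall>(U, c)\<in>A. \<forall>(V, d)\<in>A. smooth_on (c ` (U \<inter> V)) (d \<circ> inv_into U c))"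

definition smooth_fun :: "'m::topological_space atlas \<Rightarrow> 'm set \<Rightarrow> ('m \<Rightarrow> real) \<Rightarrow> bool" where
  "smooth_fun A U f \<longleftrightarrow> (\<forall>(V, c)\<in>A. smooth_on (c ` (U \<inter> V)) (f \<circ> inv_into V c))"

definition smooth_near :: "'m::topological_space atlas \<Rightarrow> 'm \<Rightarrow> ('m \<Rightarrow> real) \<Rightarrow> bool" where
  "smooth_near A p f \<longleftrightarrow> (\<exists>U. open U \<and> p \<in> U \<and> smooth_fun A U f)"

text \<open>
  A tangent vector at \<open>p\<close> is the directional derivative at \<open>p\<close> along some direction \<open>w\<close> of
  a chart, as an operator on the functions that are smooth near \<open>p\<close>. It takes the dummy
  value \<open>0\<close> on all other functions, so that a tangent vector is determined by its action on
  germs of smooth functions. Sums and differences of tangent vectors and of vector fields are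
  the pointwise ones.
\<close>

type_synonym 'm tvec = "('m \<Rightarrow> real) \<Rightarrow> real"
type_synonym 'm vfield = "'m \<Rightarrow> 'm tvec"

definition tscale :: "real \<Rightarrow> 'm tvec \<Rightarrow> 'm tvec" (infixr "*\<^sub>T" 75) where
  "a *\<^sub>T v = (\<lambda>f. a * v f)"

definition tangent_space :: "'m::topological_space atlas \<Rightarrow> 'm \<Rightarrow> 'm tvec set" where
  "tangent_space A p =
     {v. \<exists>(U, c)\<in>A. p \<in> U \<and>
        (\<exists>w. v = (\<lambda>f. if smooth_near A p f
                     then frechet_derivative (f \<circ> inv_into U c) (at (c p)) w else 0))}"

definition tangent_basis ::
  "'m::topological_space atlas \<Rightarrow> 'm \<Rightarrow> 'm tvec \<Rightarrow> 'm tvec \<Rightarrow> 'm tvec \<Rightarrow> bool" where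
  "tangent_basis A p u v w \<longleftrightarrow>
     u \<in> tangent_space A p \<and> v \<in> tangent_space A p \<and> w \<in> tangent_space A p \<and>
     (\<forall>z\<in>tangent_space A p. \<exists>!(a, b, c). z = a *\<^sub>T u + b *\<^sub>T v + c *\<^sub>T w)"

text \<open>Here and below, \<open>U\<close> is meant to be open, and \<open>X\<close> is arbitrary outside \<open>U\<close>.\<close>

definition smooth_vfield :: "'m::topological_space atlas \<Rightarrow> 'm set \<Rightarrow> 'm vfield \<Rightarrow> bool" where
  "smooth_vfield A U X \<longleftrightarrow>
     (\<forall>p\<in>U. X p \<in> tangent_space A p) \<and>
     (\<forall>V f. open V \<and> V \<subseteq> U \<and> smooth_fun A V f \<longrightarrow> smooth_fun A V (\<lambda>p. X p f))"

definition lie_bracket :: "'m::topological_space atlas \<Rightarrow> 'm vfield \<Rightarrow> 'm vfield \<Rightarrow> 'm vfield" where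
  "lie_bracket A X Y p =
     (\<lambda>f. if smooth_near A p f then X p (\<lambda>q. Y q f) - Y p (\<lambda>q. X q f) else 0)"

type_synonym 'm tensor11 = "'m \<Rightarrow> 'm tvec \<Rightarrow> 'm tvec"
type_synonym 'm form1 = "'m \<Rightarrow> 'm tvec \<Rightarrow> real"
type_synonym 'm bilin = "'m \<Rightarrow> 'm tvec \<Rightarrow> 'm tvec \<Rightarrow> real"

definition app :: "'m tensor11 \<Rightarrow> 'm vfield \<Rightarrow> 'm vfield" where
  "app \<phi> X = (\<lambda>p. \<phi> p (X p))"

definition smooth_tensor11 :: "'m::topological_space atlas \<Rightarrow> 'm tensor11 \<Rightarrow> bool" where
  "smooth_tensor11 A \<phi> \<longleftrightarrow>
     (\<forall>p. \<forall>u\<in>tangent_space A p. \<phi> p u \<in> tangent_space A p) \<and>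
     (\<forall>p a b. \<forall>u\<in>tangent_space A p. \<forall>v\<in>tangent_space A p.
        \<phi> p (a *\<^sub>T u + b *\<^sub>T v) = a *\<^sub>T \<phi> p u + b *\<^sub>T \<phi> p v) \<and>
     (\<forall>U X. open U \<and> smooth_vfield A U X \<longrightarrow> smooth_vfield A U (app \<phi> X))"

definition smooth_form1 :: "'m::topological_space atlas \<Rightarrow> 'm form1 \<Rightarrow> bool" where
  "smooth_form1 A \<eta> \<longleftrightarrow>
     (\<forall>p a b. \<forall>u\<in>tangent_space A p. \<forall>v\<in>tangent_space A p.
        \<eta> p (a *\<^sub>T u + b *\<^sub>T v) = a * \<eta> p u + b * \<eta> p v) \<and>
     (\<forall>U X. open U \<and> smooth_vfield A U X \<longrightarrow> smooth_fun A U (\<lambda>p. \<eta> p (X p)))"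

definition metric21 :: "'m::topological_space atlas \<Rightarrow> 'm bilin \<Rightarrow> bool" where
  "metric21 A g \<longleftrightarrow>
     (\<forall>p. \<forall>u\<in>tangent_space A p. \<forall>v\<in>tangent_space A p. g p u v = g p v u) \<and>
     (\<forall>p a b. \<forall>u\<in>tangent_space A p. \<forall>v\<in>tangent_space A p. \<forall>w\<in>tangent_space A p.
        g p (a *\<^sub>T u + b *\<^sub>T v) w = a * g p u w + b * g p v w) \<and>
     (\<forall>U X Y. open U \<and> smooth_vfield A U X \<and> smooth_vfield A U Y \<longrightarrow>
        smooth_fun A U (\<lambda>p. g p (X p) (Y p))) \<and>
     (\<forall>p. \<exists>e1 e2 e3. tangent_basis A p e1 e2 e3 \<and>
        g p e1 e1 = 1 \<and> g p e2 e2 = 1 \<and> g p e3 e3 = - 1 \<and>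
        g p e1 e2 = 0 \<and> g p e1 e3 = 0 \<and> g p e2 e3 = 0)"

text \<open>
  A connection is written as \<open>D p v Y\<close> for the covariant derivative of a vector field \<open>Y\<close>,
  smooth near \<open>p\<close>, in the direction of the tangent vector \<open>v\<close> at \<open>p\<close>. The last but one
  clause says that it only depends on the values of \<open>Y\<close> near \<open>p\<close>.
\<close>

type_synonym 'm conn = "'m \<Rightarrow> 'm tvec \<Rightarrow> 'm vfield \<Rightarrow> 'm tvec"

definition cov :: "'m conn \<Rightarrow> 'm vfield \<Rightarrow> 'm vfield \<Rightarrow> 'm vfield" where
  "cov D X Y = (\<lambda>p. D p (X p) Y)"

definition affine_connection :: "'m::topological_space atlas \<Rightarrow> 'm conn \<Rightarrow> bool" where
  "affine_connection A D \<longleftrightarrow>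
     (\<forall>U Y p. open U \<and> smooth_vfield A U Y \<and> p \<in> U \<longrightarrow>
        (\<forall>v\<in>tangent_space A p. D p v Y \<in> tangent_space A p) \<and>
        (\<forall>a b. \<forall>u\<in>tangent_space A p. \<forall>v\<in>tangent_space A p.
           D p (a *\<^sub>T u + b *\<^sub>T v) Y = a *\<^sub>T D p u Y + b *\<^sub>T D p v Y) \<and>
        (\<forall>Z. \<forall>v\<in>tangent_space A p. smooth_vfield A U Z \<longrightarrow>
           D p v (Y + Z) = D p v Y + D p v Z) \<and>
        (\<forall>f. \<forall>v\<in>tangent_space A p. smooth_fun A U f \<longrightarrow>
           D p v (\<lambda>q. f q *\<^sub>T Y q) = v f *\<^sub>T Y p + f p *\<^sub>T D p v Y) \<and>
        (\<forall>Z. \<forall>v\<in>tangent_space A p. (\<forall>q\<in>U. Z q = Y q) \<longrightarrow> D p v Z = D p v Y)) \<and>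
     (\<forall>U X Y. open U \<and> smooth_vfield A U X \<and> smooth_vfield A U Y \<longrightarrow>
        smooth_vfield A U (cov D X Y))"

definition torsion_free :: "'m::topological_space atlas \<Rightarrow> 'm conn \<Rightarrow> bool" where
  "torsion_free A D \<longleftrightarrow>
     (\<forall>U X Y. open U \<and> smooth_vfield A U X \<and> smooth_vfield A U Y \<longrightarrow>
        (\<forall>p\<in>U. cov D X Y p - cov D Y X p = lie_bracket A X Y p))"

definition metric_connection :: "'m::topological_space atlas \<Rightarrow> 'm bilin \<Rightarrow> 'm conn \<Rightarrow> bool" where
  "metric_connection A g D \<longleftrightarrow>
     (\<forall>U X Y Z. open U \<and> smooth_vfield A U X \<and> smooth_vfield A U Y \<and> smooth_vfield A U Z \<longrightarrow>
        (\<forall>p\<in>U. X p (\<lambda>q. g q (Y q) (Z q)) =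
           g p (cov D X Y p) (Z p) + g p (Y p) (cov D X Z p)))"

definition levi_civita :: "'m::topological_space atlas \<Rightarrow> 'm bilin \<Rightarrow> 'm conn \<Rightarrow> bool" where
  "levi_civita A g D \<longleftrightarrow>
     affine_connection A D \<and> torsion_free A D \<and> metric_connection A g D"

definition curvature ::
  "'m::topological_space atlas \<Rightarrow> 'm conn \<Rightarrow> 'm vfield \<Rightarrow> 'm vfield \<Rightarrow> 'm vfield \<Rightarrow> 'm vfield" where
  "curvature A D X Y Z =
     cov D X (cov D Y Z) - cov D Y (cov D X Z) - cov D (lie_bracket A X Y) Z"

definition almost_paracontact_metric ::
  "'m::topological_space atlas \<Rightarrow> 'm tensor11 \<Rightarrow> 'm vfield \<Rightarrow> 'm form1 \<Rightarrow> 'm bilin \<Rightarrow> bool" where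
  "almost_paracontact_metric A \<phi> \<xi> \<eta> g \<longleftrightarrow>
     smooth_tensor11 A \<phi> \<and> smooth_vfield A UNIV \<xi> \<and> smooth_form1 A \<eta> \<and> metric21 A g \<and>
     (\<forall>p. \<forall>v\<in>tangent_space A p. \<phi> p (\<phi> p v) = v - \<eta> p v *\<^sub>T \<xi> p) \<and>
     (\<forall>p. \<eta> p (\<xi> p) = 1) \<and>
     (\<forall>p. \<forall>u\<in>tangent_space A p. \<forall>v\<in>tangent_space A p.
        g p (\<phi> p u) (\<phi> p v) = - g p u v + \<eta> p u * \<eta> p v)"

definition fundamental_form :: "'m tensor11 \<Rightarrow> 'm bilin \<Rightarrow> 'm bilin" where
  "fundamental_form \<phi> g p u v = g p u (\<phi> p v)"

definition ext_deriv ::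
  "'m::topological_space atlas \<Rightarrow> 'm form1 \<Rightarrow> 'm vfield \<Rightarrow> 'm vfield \<Rightarrow> 'm \<Rightarrow> real" where
  "ext_deriv A \<eta> X Y p =
     (X p (\<lambda>q. \<eta> q (Y q)) - Y p (\<lambda>q. \<eta> q (X q)) - \<eta> p (lie_bracket A X Y p)) / 2"

definition paracontact_metric ::
  "'m::topological_space atlas \<Rightarrow> 'm tensor11 \<Rightarrow> 'm vfield \<Rightarrow> 'm form1 \<Rightarrow> 'm bilin \<Rightarrow> bool" where
  "paracontact_metric A \<phi> \<xi> \<eta> g \<longleftrightarrow>
     almost_paracontact_metric A \<phi> \<xi> \<eta> g \<and>
     (\<forall>U X Y. open U \<and> smooth_vfield A U X \<and> smooth_vfield A U Y \<longrightarrow>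
        (\<forall>p\<in>U. ext_deriv A \<eta> X Y p = fundamental_form \<phi> g p (X p) (Y p)))"

definition nijenhuis ::
  "'m::topological_space atlas \<Rightarrow> 'm tensor11 \<Rightarrow> 'm vfield \<Rightarrow> 'm vfield \<Rightarrow> 'm vfield" where
  "nijenhuis A \<phi> X Y =
     app \<phi> (app \<phi> (lie_bracket A X Y)) + lie_bracket A (app \<phi> X) (app \<phi> Y)
     - app \<phi> (lie_bracket A (app \<phi> X) Y + lie_bracket A X (app \<phi> Y))"

definition normal_structure ::
  "'m::topological_space atlas \<Rightarrow> 'm tensor11 \<Rightarrow> 'm vfield \<Rightarrow> 'm form1 \<Rightarrow> bool" where
  "normal_structure A \<phi> \<xi> \<eta> \<longleftrightarrow>
     (\<forall>U X Y. open U \<and> smooth_vfield A U X \<and> smooth_vfield A U Y \<longrightarrow>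
        (\<forall>p\<in>U. nijenhuis A \<phi> X Y p - (2 * ext_deriv A \<eta> X Y p) *\<^sub>T \<xi> p = 0))"

definition para_sasakian ::
  "'m::topological_space atlas \<Rightarrow> 'm tensor11 \<Rightarrow> 'm vfield \<Rightarrow> 'm form1 \<Rightarrow> 'm bilin \<Rightarrow> bool" where
  "para_sasakian A \<phi> \<xi> \<eta> g \<longleftrightarrow>
     paracontact_metric A \<phi> \<xi> \<eta> g \<and> normal_structure A \<phi> \<xi> \<eta>"

text \<open>Half the Lie derivative of \<open>\<phi>\<close> along \<open>\<xi>\<close>, as an operator on vector fields.\<close>

definition h_op ::
  "'m::topological_space atlas \<Rightarrow> 'm tensor11 \<Rightarrow> 'm vfield \<Rightarrow> 'm vfield \<Rightarrow> 'm vfield" where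
  "h_op A \<phi> \<xi> X p = (1 / 2) *\<^sub>T (lie_bracket A \<xi> (app \<phi> X) p - \<phi> p (lie_bracket A \<xi> X p))"

definition kappa_mu_space ::
  "'m::topological_space atlas \<Rightarrow> 'm tensor11 \<Rightarrow> 'm vfield \<Rightarrow> 'm form1 \<Rightarrow> 'm conn \<Rightarrow>
   real \<Rightarrow> real \<Rightarrow> bool" where
  "kappa_mu_space A \<phi> \<xi> \<eta> D \<kappa> \<mu> \<longleftrightarrow>
     (\<forall>U X Y. open U \<and> smooth_vfield A U X \<and> smooth_vfield A U Y \<longrightarrow>
        (\<forall>p\<in>U. curvature A D X Y \<xi> p =
           \<kappa> *\<^sub>T (\<eta> p (Y p) *\<^sub>T X p - \<eta> p (X p) *\<^sub>T Y p)
           + \<mu> *\<^sub>T (\<eta> p (Y p) *\<^sub>T h_op A \<phi> \<xi> X p - \<eta> p (X p) *\<^sub>T h_op A \<phi> \<xi> Y p)))"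

definition artin_frame ::
  "'m::topological_space atlas \<Rightarrow> 'm tensor11 \<Rightarrow> 'm vfield \<Rightarrow> 'm bilin \<Rightarrow> 'm set \<Rightarrow>
   'm vfield \<Rightarrow> 'm vfield \<Rightarrow> bool" where
  "artin_frame A \<phi> \<xi> g U E1 E2 \<longleftrightarrow>
     smooth_vfield A U E1 \<and> smooth_vfield A U E2 \<and>
     (\<forall>q\<in>U. tangent_basis A q (\<xi> q) (E1 q) (E2 q) \<and>
        \<phi> q (E1 q) = E1 q \<and> \<phi> q (E2 q) = - E2 q \<and>
        g q (\<xi> q) (E1 q) = 0 \<and> g q (\<xi> q) (E2 q) = 0 \<and> g q (E1 q) (E2 q) = 1)"

end

(* After rescaling X by |g(X, h X)|^(-1/2) one has an Artin frame with h E1 = eps E2. The Levi-Civita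
   connection of such a frame depends on six functions. With B = g(nabla_E1 xi, E2) and
   C = g(nabla_E2 xi, E1), the contact condition gives C = B + 2, while the diagonal components
   of R(xi, E1)xi and R(xi, E2)xi give xi(B) + B^2 = xi(C) + C^2. So B^2 = C^2, that is
   B = - 1 and C = 1. The other components of the curvature condition are then algebraic equations
   for the remaining functions. *)

theory Submission
  imports Defs
begin

text \<open>The rescaling rests on h being linear over functions on the +1 eigenspace of phi: g(f X,
  h(f X)) = f^2 g(X, h X), so a factor f can normalise the modulus but not the sign, and this sign
  is eps. That g(X, h X) is nonzero needs an argument of its own, since h acts on fields and X(p) is
  not known to be nonzero. The values B = -1 and C = 1 are part of the classical identity nabla_X xi
  = - phi X + phi (h X), which holds on every paracontact metric manifold. Here they are read off
  from the curvature instead: kappa and the unknown K = g(nabla_E2 xi, E2) enter both diagonal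
  components in the same way and cancel, and xi(C) = xi(B) because C - B is constant. Second
  covariant derivatives of xi are avoided: pairing the curvature with a frame field turns them into
  derivatives of component functions, most of which turn out to be constant. The coefficient b may
  survive for kappa = -1 because R(E1, E2)xi = 0 restricts it only by K b = 0, where K = eps (kappa
  + 1).\<close>

section \<open>Calculus of \<open>C\<^sup>k\<close> functions\<close>

lemma Ck_on_subset: "Ck_on k S f \<Longrightarrow> T \<subseteq> S \<Longrightarrow> Ck_on k T f"
  by (induction k arbitrary: f) (auto intro: continuous_on_subset)

lemma Ck_on_SucD: "Ck_on (Suc k) S f \<Longrightarrow> Ck_on k S f"
proof (induction k arbitrary: f)
  case 0
  then show ?case
    by (auto intro!: differentiable_imp_continuous_on simp: differentiable_on_def differentiable_at_withinI)
next
  case (Suc k)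
  then show ?case by auto
qed

text \<open>Charts are inverted by \<open>inv_into\<close>, whose values off the chart image are
  arbitrary, so derivatives must be seen to depend only on the values in an open set.\<close>

lemma frechet_derivative_cong_open:
  assumes "open S" "x \<in> S" "\<And>y. y \<in> S \<Longrightarrow> f y = g y"
  shows "frechet_derivative f (at x) = frechet_derivative g (at x)"
    and "f differentiable at x \<longleftrightarrow> g differentiable at x"
proof -
  have "(f has_derivative F) (at x) \<longleftrightarrow> (g has_derivative F) (at x)" for F
    using assms has_derivative_transform_within_open[of f F x UNIV S g]
      has_derivative_transform_within_open[of g F x UNIV S f] by auto
  then show "frechet_derivative f (at x) = frechet_derivative g (at x)"
    and "f differentiable at x \<longleftrightarrow> g differentiable at x"
    by (auto simp: frechet_derivative_def differentiable_def)
qed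

lemma Ck_on_cong:
  assumes "open S" "\<And>x. x \<in> S \<Longrightarrow> f x = g x"
  shows "Ck_on k S f \<longleftrightarrow> Ck_on k S g"
  using assms(2)
proof (induction k arbitrary: f g)
  case 0
  then show ?case by (simp cong: continuous_on_cong)
next
  case (Suc k)
  have "Ck_on k S (\<lambda>x. frechet_derivative f (at x) v) \<longleftrightarrow> Ck_on k S (\<lambda>x. frechet_derivative g (at x) v)" for v
    by (rule Suc.IH) (use frechet_derivative_cong_open[OF assms(1) _ Suc.prems] in auto)
  then show ?case
    using frechet_derivative_cong_open(2)[OF assms(1) _ Suc.prems] by auto
qed

lemma Ck_on_const: "Ck_on k S (\<lambda>x. c)"
  by (induction k arbitrary: c) auto

text \<open>With \<open>Ck_on_SucE\<close> this lets the inductions below use any convenient formula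
  \<open>F\<close> for the derivative. The formula need only hold on \<open>S\<close>, which is
  enough because \<open>S\<close> is open.\<close>

lemma Ck_on_SucI:
  assumes "open S" "\<And>x. x \<in> S \<Longrightarrow> (f has_derivative F x) (at x)"
    "\<And>v. Ck_on k S (\<lambda>x. F x v)"
  shows "Ck_on (Suc k) S f"
proof -
  have F: "frechet_derivative f (at x) = F x" if "x \<in> S" for x
    using assms(2)[OF that] frechet_derivative_at by metis
  have "Ck_on k S (\<lambda>x. frechet_derivative f (at x) v)" for v
    using Ck_on_cong[OF assms(1), of "\<lambda>x. frechet_derivative f (at x) v" "\<lambda>x. F x v" k] F assms(3) by auto
  then show ?thesis
    using assms(2) by (auto simp: differentiable_def)
qed

lemma Ck_on_SucE:
  assumes "Ck_on (Suc k) S f"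
  obtains F where "\<And>x. x \<in> S \<Longrightarrow> (f has_derivative F x) (at x)" "\<And>v. Ck_on k S (\<lambda>x. F x v)"
proof
  show "(f has_derivative frechet_derivative f (at x)) (at x)" if "x \<in> S" for x
    using assms that by (simp add: frechet_derivative_works)
  show "Ck_on k S (\<lambda>x. frechet_derivative f (at x) v)" for v
    using assms by simp
qed

lemma Ck_on_add:
  assumes "open S" "Ck_on k S f" "Ck_on k S g"
  shows "Ck_on k S (\<lambda>x. f x + g x)"
  using assms(2,3)
proof (induction k arbitrary: f g)
  case 0
  then show ?case by (auto intro: continuous_intros)
next
  case (Suc k)
  obtain F G where "\<And>x. x \<in> S \<Longrightarrow> (f has_derivative F x) (at x)" "\<And>v. Ck_on k S (\<lambda>x. F x v)"
    "\<And>x. x \<in> S \<Longrightarrow> (g has_derivative G x) (at x)" "\<And>v. Ck_on k S (\<lambda>x. G x v)"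
    using Suc.prems by (metis Ck_on_SucE)
  then show ?case
    by (intro Ck_on_SucI[where F = "\<lambda>x v. F x v + G x v"] assms(1) Suc.IH has_derivative_add) auto
qed

lemma Ck_on_mult:
  fixes f g :: "'a::real_normed_vector \<Rightarrow> real"
  assumes "open S" "Ck_on k S f" "Ck_on k S g"
  shows "Ck_on k S (\<lambda>x. f x * g x)"
  using assms(2,3)
proof (induction k arbitrary: f g)
  case 0
  then show ?case by (auto intro: continuous_intros)
next
  case (Suc k)
  obtain F G where "\<And>x. x \<in> S \<Longrightarrow> (f has_derivative F x) (at x)" "\<And>v. Ck_on k S (\<lambda>x. F x v)"
    "\<And>x. x \<in> S \<Longrightarrow> (g has_derivative G x) (at x)" "\<And>v. Ck_on k S (\<lambda>x. G x v)"
    using Suc.prems by (metis Ck_on_SucE)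
  then show ?case
    using Suc.prems[THEN Ck_on_SucD]
    by (intro Ck_on_SucI[where F = "\<lambda>x v. f x * G x v + F x v * g x"] assms(1)
        Ck_on_add[OF assms(1)] Suc.IH has_derivative_mult) auto
qed

lemma Ck_on_sum:
  assumes "open S" "finite I" "\<And>i. i \<in> I \<Longrightarrow> Ck_on k S (f i)"
  shows "Ck_on k S (\<lambda>x. \<Sum>i\<in>I. f i x)"
  using assms(2,3) by (induction I rule: finite_induct) (auto intro: Ck_on_const Ck_on_add[OF assms(1)])

lemma Ck_on_bounded_linear:
  assumes "open S" "bounded_linear L" "Ck_on k S f"
  shows "Ck_on k S (\<lambda>x. L (f x))"
  using assms(3)
proof (induction k arbitrary: f)
  case 0
  then show ?case
    by (auto intro: bounded_linear.continuous_on[OF assms(2)])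
next
  case (Suc k)
  obtain F where "\<And>x. x \<in> S \<Longrightarrow> (f has_derivative F x) (at x)" "\<And>v. Ck_on k S (\<lambda>x. F x v)"
    using Suc.prems by (metis Ck_on_SucE)
  then show ?case
    by (intro Ck_on_SucI[where F = "\<lambda>x v. L (F x v)"] assms(1)
        bounded_linear.has_derivative[OF assms(2)] Suc.IH) auto
qed

text \<open>The derivative contains the exponent a - 1, so the induction must keep \<open>a\<close>
  arbitrary.\<close>

lemma Ck_on_powr:
  fixes f :: "'a::real_normed_vector \<Rightarrow> real"
  assumes "open S" "\<And>x. x \<in> S \<Longrightarrow> f x > 0" "Ck_on k S f"
  shows "Ck_on k S (\<lambda>x. f x powr a)"
  using assms(3)
proof (induction k arbitrary: a)
  case 0
  then show ?case using assms(2) by (force intro: continuous_intros)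
next
  case (Suc k)
  obtain F where F: "\<And>x. x \<in> S \<Longrightarrow> (f has_derivative F x) (at x)" "\<And>v. Ck_on k S (\<lambda>x. F x v)"
    using Suc.prems by (metis Ck_on_SucE)
  show ?case
  proof (rule Ck_on_SucI[where F = "\<lambda>x v. a * (f x powr (a - 1) * F x v)"])
    show "((\<lambda>x. f x powr a) has_derivative (\<lambda>v. a * (f x powr (a - 1) * F x v))) (at x)" if "x \<in> S" for x
      using F(1)[OF that] assms(2)[OF that]
      by (auto intro!: derivative_eq_intros simp: powr_diff field_simps)
    show "Ck_on k S (\<lambda>x. a * (f x powr (a - 1) * F x v))" for v
      using F(2) Suc.IH Suc.prems[THEN Ck_on_SucD]
      by (intro Ck_on_mult Ck_on_const assms(1)) auto
  qed (rule assms(1))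
qed

text \<open>The induction knows the derivative of \<open>f\<close> only in fixed directions, whereas
  the chain rule applies it to the moving direction \<open>G x v\<close>. Expanding this direction
  in a basis leaves products of \<open>C^k\<close> functions; hence the Euclidean space in the
  middle.\<close>

lemma Ck_on_compose:
  fixes f :: "'b::euclidean_space \<Rightarrow> real" and g :: "'a::real_normed_vector \<Rightarrow> 'b"
  assumes "open S" "Ck_on k T f" "Ck_on k S g" "g ` S \<subseteq> T"
  shows "Ck_on k S (\<lambda>x. f (g x))"
  using assms(2,3)
proof (induction k arbitrary: f)
  case 0
  then show ?case
    using continuous_on_compose2[OF _ _ assms(4)] by auto
next
  case (Suc k)
  obtain F where F: "\<And>x. x \<in> T \<Longrightarrow> (f has_derivative F x) (at x)" "\<And>v. Ck_on k T (\<lambda>x. F x v)"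
    using Suc.prems(1) by (metis Ck_on_SucE)
  obtain G where G: "\<And>x. x \<in> S \<Longrightarrow> (g has_derivative G x) (at x)" "\<And>v. Ck_on k S (\<lambda>x. G x v)"
    using Suc.prems(2) by (metis Ck_on_SucE)
  show ?case
  proof (rule Ck_on_SucI[where F = "\<lambda>x v. \<Sum>i\<in>Basis. (G x v \<bullet> i) * F (g x) i"])
    fix x assume x: "x \<in> S"
    have gx: "(f has_derivative F (g x)) (at (g x))"
      using F(1) assms(4) x by auto
    then interpret L: linear "F (g x)"
      using has_derivative_linear by blast
    have "F (g x) (G x v) = (\<Sum>i\<in>Basis. (G x v \<bullet> i) * F (g x) i)" for v
      using L.sum[of "\<lambda>i. (G x v \<bullet> i) *\<^sub>R i" Basis]
      by (simp add: L.scaleR euclidean_representation)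
    with gx show "((\<lambda>x. f (g x)) has_derivative (\<lambda>v. \<Sum>i\<in>Basis. (G x v \<bullet> i) * F (g x) i)) (at x)"
      using has_derivative_compose[OF G(1)[OF x] gx] by simp
  next
    show "Ck_on k S (\<lambda>x. \<Sum>i\<in>Basis. (G x v \<bullet> i) * F (g x) i)" for v
      using Suc.prems(2)[THEN Ck_on_SucD] F(2) G(2)
      by (intro Ck_on_sum Ck_on_mult Ck_on_bounded_linear[of S "\<lambda>y. y \<bullet> _"]
          bounded_linear_inner_left Suc.IH assms(1)) auto
  qed (rule assms(1))
qed

section \<open>Tangent vectors and vector fields\<close>

text \<open>Names the operator inside \<open>tangent_space\<close>, so that its dependence on the
  chart can be studied.\<close>

definition chart_vec :: "'m::t2_space atlas \<Rightarrow> 'm set \<Rightarrow> ('m \<Rightarrow> real ^ 3) \<Rightarrow> 'm \<Rightarrow> real ^ 3 \<Rightarrow> 'm tvec" where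
  "chart_vec A U c p w = (\<lambda>f. if smooth_near A p f
     then frechet_derivative (f \<circ> inv_into U c) (at (c p)) w else 0)"

lemma tscale_simps [simp]: "0 *\<^sub>T v = 0" "a *\<^sub>T 0 = 0" "1 *\<^sub>T v = v" "(- 1) *\<^sub>T v = - v"
  by (auto simp: tscale_def fun_eq_iff)

lemma tangent_space_chart_vec:
  "tangent_space A p = {chart_vec A U c p w | U c w. (U, c) \<in> A \<and> p \<in> U}"
  unfolding tangent_space_def chart_vec_def by blast

locale smooth_manifold =
  fixes A :: "'m::t2_space atlas"
  assumes atlas: "smooth_atlas A"
begin

section \<open>Charts and smooth functions\<close>

lemma chart_exists: obtains U c where "(U, c) \<in> A" "p \<in> U"
  using atlas unfolding smooth_atlas_def by blast

lemma chart_open: "(U, c) \<in> A \<Longrightarrow> open U"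
  using atlas unfolding smooth_atlas_def by blast

lemma chart_homeomorphism: "(U, c) \<in> A \<Longrightarrow> homeomorphism U (c ` U) c (inv_into U c)"
  using atlas unfolding smooth_atlas_def by blast

lemma inv_chart [simp]: "(U, c) \<in> A \<Longrightarrow> p \<in> U \<Longrightarrow> inv_into U c (c p) = p"
  using chart_homeomorphism homeomorphism_apply1 by blast

lemma chart_image_open:
  assumes "(U, c) \<in> A" "open V"
  shows "open (c ` (V \<inter> U))"
proof -
  have "openin (top_of_set (c ` U)) (c ` (V \<inter> U))"
    by (rule homeomorphism_imp_open_map[OF chart_homeomorphism[OF assms(1)]])
      (use assms(2) in \<open>simp add: inf_commute openin_open_Int\<close>)
  moreover have "open (c ` U)"
    using atlas assms(1) unfolding smooth_atlas_def by blast
  ultimately show ?thesis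
    using openin_open_trans by blast
qed

lemma transition_smooth:
  assumes "(U, c) \<in> A" "(V, d) \<in> A"
  shows "smooth_on (c ` (U \<inter> V)) (d \<circ> inv_into U c)"
  using atlas assms unfolding smooth_atlas_def by blast

lemma smooth_fun_subset: "smooth_fun A U f \<Longrightarrow> V \<subseteq> U \<Longrightarrow> smooth_fun A V f"
  unfolding smooth_fun_def smooth_on_def by (fast intro: Ck_on_subset)

lemma smooth_funI:
  assumes "\<And>k V c. (V, c) \<in> A \<Longrightarrow> Ck_on k (c ` (U \<inter> V)) (f \<circ> inv_into V c)"
  shows "smooth_fun A U f"
  using assms unfolding smooth_fun_def smooth_on_def by auto

lemma smooth_funD:
  "smooth_fun A U f \<Longrightarrow> (V, c) \<in> A \<Longrightarrow> Ck_on k (c ` (U \<inter> V)) (f \<circ> inv_into V c)"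
  unfolding smooth_fun_def smooth_on_def by auto

lemma smooth_fun_cong:
  assumes "open U" "\<And>x. x \<in> U \<Longrightarrow> f x = g x" "smooth_fun A U f"
  shows "smooth_fun A U g"
proof (rule smooth_funI)
  fix k V c assume "(V, c) \<in> A"
  then show "Ck_on k (c ` (U \<inter> V)) (g \<circ> inv_into V c)"
    using Ck_on_cong[OF chart_image_open[of V c U], of "f \<circ> inv_into V c" "g \<circ> inv_into V c" k]
      smooth_funD[OF assms(3), of V c k] assms(1,2) by force
qed

lemma smooth_fun_const: "smooth_fun A U (\<lambda>x. a)"
  by (rule smooth_funI) (simp add: o_def Ck_on_const)

lemma smooth_fun_add:
  assumes "open U" "smooth_fun A U f" "smooth_fun A U g"
  shows "smooth_fun A U (\<lambda>x. f x + g x)"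
  using Ck_on_add[OF chart_image_open[OF _ assms(1)] smooth_funD[OF assms(2)] smooth_funD[OF assms(3)]]
  by (intro smooth_funI) (simp add: o_def)

lemma smooth_fun_mult:
  assumes "open U" "smooth_fun A U f" "smooth_fun A U g"
  shows "smooth_fun A U (\<lambda>x. f x * g x)"
  using Ck_on_mult[OF chart_image_open[OF _ assms(1)] smooth_funD[OF assms(2)] smooth_funD[OF assms(3)]]
  by (intro smooth_funI) (simp add: o_def)

lemma smooth_fun_powr:
  assumes "open U" "smooth_fun A U f" "\<And>x. x \<in> U \<Longrightarrow> f x > 0"
  shows "smooth_fun A U (\<lambda>x. f x powr a)"
proof (rule smooth_funI)
  fix k V c assume V: "(V, c) \<in> A"
  have "Ck_on k (c ` (U \<inter> V)) (\<lambda>x. (f \<circ> inv_into V c) x powr a)"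
    by (rule Ck_on_powr[OF chart_image_open[OF V assms(1)] _ smooth_funD[OF assms(2) V]])
      (use V assms(3) in auto)
  then show "Ck_on k (c ` (U \<inter> V)) ((\<lambda>x. f x powr a) \<circ> inv_into V c)"
    by (simp add: o_def)
qed

text \<open>Continuity supplies the open sets on which a scalar product of fields stays nonzero or
  keeps its sign.\<close>

lemma smooth_fun_continuous:
  assumes "open U" "smooth_fun A U f"
  shows "continuous_on U f"
proof -
  have "isCont f x" if x: "x \<in> U" for x
  proof -
    obtain V c where V: "(V, c) \<in> A" "x \<in> V" by (rule chart_exists)
    have "continuous_on (c ` (U \<inter> V)) (f \<circ> inv_into V c)"
      using smooth_funD[OF assms(2) V(1), of 0] by simp
    moreover have "continuous_on (U \<inter> V) c"
      using chart_homeomorphism[OF V(1)] homeomorphism_cont1 continuous_on_subset by blast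
    ultimately have "continuous_on (U \<inter> V) ((f \<circ> inv_into V c) \<circ> c)"
      by (rule continuous_on_compose[rotated])
    then have "continuous_on (U \<inter> V) f"
      by (rule continuous_on_eq) (use V in auto)
    then show ?thesis
      using continuous_on_eq_continuous_at[of "U \<inter> V" f] assms(1) chart_open V x by blast
  qed
  then show ?thesis
    by (simp add: continuous_at_imp_continuous_on)
qed

lemma smooth_nearI: "open U \<Longrightarrow> p \<in> U \<Longrightarrow> smooth_fun A U f \<Longrightarrow> smooth_near A p f"
  unfolding smooth_near_def by blast

text \<open>A tangent vector tests its argument for smoothness near p before differentiating it, so
  locality of tangent vectors presupposes locality of this test.\<close>

lemma smooth_near_cong:
  assumes "open V" "p \<in> V" "\<And>x. x \<in> V \<Longrightarrow> f x = g x"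
  shows "smooth_near A p f \<longleftrightarrow> smooth_near A p g"
proof -
  have "smooth_near A p g" if fg: "\<And>x. x \<in> V \<Longrightarrow> f x = g x" and f: "smooth_near A p f" for f g
  proof -
    obtain U where U: "open U" "p \<in> U" "smooth_fun A U f"
      using f unfolding smooth_near_def by blast
    then have "smooth_fun A (U \<inter> V) f"
      by (auto intro: smooth_fun_subset)
    then have "smooth_fun A (U \<inter> V) g"
      by (rule smooth_fun_cong[rotated 2]) (use fg assms(1) U in auto)
    then show ?thesis
      using smooth_nearI[of "U \<inter> V"] U assms(1,2) by blast
  qed
  then show ?thesis using assms(3) by metis
qed

section \<open>Tangent vectors in coordinates\<close>

lemma smooth_near_chart_differentiable:
  assumes "smooth_near A p f" "(U, c) \<in> A" "p \<in> U"
  shows "(f \<circ> inv_into U c) differentiable at (c p)"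
proof -
  obtain V where V: "open V" "p \<in> V" "smooth_fun A V f"
    using assms(1) unfolding smooth_near_def by blast
  then show ?thesis
    using smooth_funD[OF V(3) assms(2), of 1] assms(3) by auto
qed

lemma transition_differentiable:
  assumes "(U, c) \<in> A" "(V, d) \<in> A" "p \<in> U" "p \<in> V"
  shows "(d \<circ> inv_into U c) differentiable at (c p)"
proof -
  have "Ck_on 1 (c ` (U \<inter> V)) (d \<circ> inv_into U c)"
    using transition_smooth[OF assms(1,2)] unfolding smooth_on_def by blast
  then show ?thesis using assms by auto
qed

text \<open>The chain rule for the transition map: directions transform by its Jacobian. On
  functions that are not smooth near p both sides have the dummy value 0.\<close>

lemma chart_vec_change:
  assumes U: "(U, c) \<in> A" "p \<in> U" and V: "(V, d) \<in> A" "p \<in> V"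
  shows "chart_vec A U c p w =
    chart_vec A V d p (frechet_derivative (d \<circ> inv_into U c) (at (c p)) w)"
proof
  fix f
  show "chart_vec A U c p w f = chart_vec A V d p (frechet_derivative (d \<circ> inv_into U c) (at (c p)) w) f"
  proof (cases "smooth_near A p f")
    case True
    have "frechet_derivative (f \<circ> inv_into U c) (at (c p)) =
        frechet_derivative ((f \<circ> inv_into V d) \<circ> (d \<circ> inv_into U c)) (at (c p))"
      by (rule frechet_derivative_cong_open[OF chart_image_open[OF U(1) chart_open[OF V(1)]]])
        (use U V in auto)
    also have "\<dots> = frechet_derivative (f \<circ> inv_into V d) (at ((d \<circ> inv_into U c) (c p))) \<circ>
        frechet_derivative (d \<circ> inv_into U c) (at (c p))"
      by (rule frechet_derivative_compose)
        (use transition_differentiable[OF U(1) V(1)] smooth_near_chart_differentiable[OF True V] U V in auto)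
    finally show ?thesis
      using True U V by (simp add: chart_vec_def)
  qed (simp add: chart_vec_def)
qed

lemma chart_vec_in_tangent_space: "(U, c) \<in> A \<Longrightarrow> p \<in> U \<Longrightarrow> chart_vec A U c p w \<in> tangent_space A p"
  unfolding tangent_space_chart_vec by blast

text \<open>The definition of \<open>tangent_space\<close> provides some chart; the change of charts
  permits a prescribed one, so that several vectors at p can be written in the same
  coordinates.\<close>

lemma tangent_vec_chartE:
  assumes "v \<in> tangent_space A p" "(U, c) \<in> A" "p \<in> U"
  obtains w where "v = chart_vec A U c p w"
  using assms chart_vec_change unfolding tangent_space_chart_vec by blast

lemma chart_vec_linear:
  assumes "(U, c) \<in> A" "p \<in> U"
  shows "chart_vec A U c p (a *\<^sub>R v + b *\<^sub>R w) = a *\<^sub>T chart_vec A U c p v + b *\<^sub>T chart_vec A U c p w"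
proof
  fix f
  have "linear (frechet_derivative (f \<circ> inv_into U c) (at (c p)))" if "smooth_near A p f"
    using smooth_near_chart_differentiable[OF that assms] linear_frechet_derivative by blast
  then show "chart_vec A U c p (a *\<^sub>R v + b *\<^sub>R w) f = (a *\<^sub>T chart_vec A U c p v + b *\<^sub>T chart_vec A U c p w) f"
    by (simp add: chart_vec_def tscale_def linear_add linear_scale)
qed

lemma tangent_space_comb:
  assumes "u \<in> tangent_space A p" "v \<in> tangent_space A p"
  shows "a *\<^sub>T u + b *\<^sub>T v \<in> tangent_space A p"
proof -
  obtain U c where U: "(U, c) \<in> A" "p \<in> U" by (rule chart_exists)
  then show ?thesis
    using assms by (metis tangent_vec_chartE chart_vec_linear chart_vec_in_tangent_space)
qed

lemma tangent_space_closed: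
  "u \<in> tangent_space A p \<Longrightarrow> v \<in> tangent_space A p \<Longrightarrow> u + v \<in> tangent_space A p"
  "u \<in> tangent_space A p \<Longrightarrow> v \<in> tangent_space A p \<Longrightarrow> u - v \<in> tangent_space A p"
  "u \<in> tangent_space A p \<Longrightarrow> a *\<^sub>T u \<in> tangent_space A p"
  "u \<in> tangent_space A p \<Longrightarrow> - u \<in> tangent_space A p"
  "0 \<in> tangent_space A p"
proof -
  obtain U c where "(U, c) \<in> A" "p \<in> U" by (rule chart_exists)
  then have "chart_vec A U c p 0 \<in> tangent_space A p"
    by (rule chart_vec_in_tangent_space)
  then show "0 \<in> tangent_space A p"
    using tangent_space_comb[of "chart_vec A U c p 0" p "chart_vec A U c p 0" 0 0] by simp
qed (use tangent_space_comb[of u p v 1 1] tangent_space_comb[of u p v 1 "- 1"]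
    tangent_space_comb[of u p u a 0] tangent_space_comb[of u p u "- 1" 0] in simp_all)

lemma tangent_vec_cong:
  assumes "v \<in> tangent_space A p" "open V" "p \<in> V" "\<And>x. x \<in> V \<Longrightarrow> f x = g x"
  shows "v f = v g"
proof -
  obtain U c where U: "(U, c) \<in> A" "p \<in> U" by (rule chart_exists)
  obtain w where w: "v = chart_vec A U c p w" using tangent_vec_chartE[OF assms(1) U] .
  have "frechet_derivative (f \<circ> inv_into U c) (at (c p)) = frechet_derivative (g \<circ> inv_into U c) (at (c p))"
    by (rule frechet_derivative_cong_open[OF chart_image_open[OF U(1) assms(2)]])
      (use U assms(3,4) in auto)
  then show ?thesis
    unfolding w chart_vec_def using smooth_near_cong[OF assms(2-4)] by simp
qed

lemma smooth_near_common:
  assumes "smooth_near A p f" "smooth_near A p g"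
  obtains U where "open U" "p \<in> U" "smooth_fun A U f" "smooth_fun A U g"
proof -
  obtain U V where "open U" "p \<in> U" "smooth_fun A U f" "open V" "p \<in> V" "smooth_fun A V g"
    using assms unfolding smooth_near_def by blast
  then show ?thesis
    using that[of "U \<inter> V"] smooth_fun_subset[of U f "U \<inter> V"] smooth_fun_subset[of V g "U \<inter> V"] by auto
qed

text \<open>Smoothness of both germs matters here: two non-smooth functions get the dummy value 0,
  although their sum may be smooth with a nonzero derivative.\<close>

lemma tangent_vec_add:
  assumes v: "v \<in> tangent_space A p" and f: "smooth_near A p f" and g: "smooth_near A p g"
  shows "v (\<lambda>x. f x + g x) = v f + v g"
proof -
  obtain U c where U: "(U, c) \<in> A" "p \<in> U" by (rule chart_exists)
  obtain w where w: "v = chart_vec A U c p w" using tangent_vec_chartE[OF v U] .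
  have n: "smooth_near A p (\<lambda>x. f x + g x)"
    using smooth_near_common[OF f g] smooth_fun_add smooth_nearI by metis
  have "((\<lambda>x. (f \<circ> inv_into U c) x + (g \<circ> inv_into U c) x) has_derivative
      (\<lambda>w. frechet_derivative (f \<circ> inv_into U c) (at (c p)) w +
         frechet_derivative (g \<circ> inv_into U c) (at (c p)) w)) (at (c p))"
    by (intro has_derivative_add)
      (use smooth_near_chart_differentiable[OF f U] smooth_near_chart_differentiable[OF g U] in
        \<open>simp_all only: frechet_derivative_works\<close>)
  from frechet_derivative_at[OF this, symmetric] show ?thesis
    using f g n unfolding w chart_vec_def by (simp add: o_def)
qed

lemma tangent_vec_const:
  assumes "v \<in> tangent_space A p"
  shows "v (\<lambda>x. a) = 0"
proof -
  obtain U c where U: "(U, c) \<in> A" "p \<in> U" by (rule chart_exists)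
  obtain w where w: "v = chart_vec A U c p w" using tangent_vec_chartE[OF assms U] .
  show ?thesis
    unfolding w chart_vec_def by (simp add: o_def)
qed

section \<open>Smooth vector fields\<close>

lemma smooth_vfieldD:
  "smooth_vfield A U X \<Longrightarrow> q \<in> U \<Longrightarrow> X q \<in> tangent_space A q"
  "smooth_vfield A U X \<Longrightarrow> open V \<Longrightarrow> V \<subseteq> U \<Longrightarrow> smooth_fun A V f \<Longrightarrow> smooth_fun A V (\<lambda>q. X q f)"
  unfolding smooth_vfield_def by blast+

lemma smooth_vfieldI:
  assumes "\<And>q. q \<in> U \<Longrightarrow> X q \<in> tangent_space A q"
    "\<And>V f. open V \<Longrightarrow> V \<subseteq> U \<Longrightarrow> smooth_fun A V f \<Longrightarrow> smooth_fun A V (\<lambda>q. X q f)"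
  shows "smooth_vfield A U X"
  using assms unfolding smooth_vfield_def by blast

lemma smooth_vfield_subset: "smooth_vfield A U X \<Longrightarrow> V \<subseteq> U \<Longrightarrow> smooth_vfield A V X"
  unfolding smooth_vfield_def by (meson subset_trans subsetD)

lemma smooth_vfield_cong:
  assumes "open U" "\<And>x. x \<in> U \<Longrightarrow> X x = Y x" "smooth_vfield A U X"
  shows "smooth_vfield A U Y"
proof -
  have "smooth_fun A V (\<lambda>q. Y q f)" if "open V" "V \<subseteq> U" "smooth_fun A V f" for V f
    by (rule smooth_fun_cong[OF that(1) _ smooth_vfieldD(2)[OF assms(3) that]])
      (use that assms(2) in \<open>auto dest: subsetD\<close>)
  then show ?thesis
    using assms unfolding smooth_vfield_def by force
qed

lemma smooth_vfield_scale:
  assumes "open U" "smooth_fun A U f" "smooth_vfield A U X"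
  shows "smooth_vfield A U (\<lambda>q. f q *\<^sub>T X q)"
proof -
  have "smooth_fun A V (\<lambda>q. (f q *\<^sub>T X q) h)" if "open V" "V \<subseteq> U" "smooth_fun A V h" for V h
    unfolding tscale_def
    by (intro smooth_fun_mult that(1) smooth_fun_subset[OF assms(2) that(2)] smooth_vfieldD(2)[OF assms(3) that])
  then show ?thesis
    by (intro smooth_vfieldI tangent_space_closed(3) smooth_vfieldD(1)[OF assms(3)])
qed

lemma smooth_vfield_add:
  assumes "open U" "smooth_vfield A U X" "smooth_vfield A U Y"
  shows "smooth_vfield A U (\<lambda>q. X q + Y q)"
proof -
  have "smooth_fun A V (\<lambda>q. (X q + Y q) h)" if "open V" "V \<subseteq> U" "smooth_fun A V h" for V h
    using smooth_fun_add[OF that(1) smooth_vfieldD(2)[OF assms(2) that] smooth_vfieldD(2)[OF assms(3) that]]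
    by simp
  then show ?thesis
    by (intro smooth_vfieldI tangent_space_closed(1) smooth_vfieldD(1)[OF assms(2)] smooth_vfieldD(1)[OF assms(3)])
qed

lemma smooth_vfield_diff:
  assumes "open U" "smooth_vfield A U X" "smooth_vfield A U Y"
  shows "smooth_vfield A U (\<lambda>q. X q - Y q)"
  using smooth_vfield_add[OF assms(1,2) smooth_vfield_scale[OF assms(1) smooth_fun_const[of U "- 1"] assms(3)]]
  by (rule smooth_vfield_cong[OF assms(1), rotated]) (simp add: tscale_def fun_eq_iff)

text \<open>The extension has constant coordinates in one chart. In any other chart, its action on a
  function is a directional derivative composed with a transition map.\<close>

lemma tangent_vec_extend:
  assumes "v \<in> tangent_space A p"
  obtains U X where "open U" "p \<in> U" "smooth_vfield A U X" "X p = v"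
proof -
  obtain U c where U: "(U, c) \<in> A" "p \<in> U" by (rule chart_exists)
  obtain w where w: "v = chart_vec A U c p w" using tangent_vec_chartE[OF assms U] .
  have "smooth_vfield A U (\<lambda>q. chart_vec A U c q w)"
    unfolding smooth_vfield_def
  proof safe
    show "chart_vec A U c q w \<in> tangent_space A q" if "q \<in> U" for q
      using chart_vec_in_tangent_space U(1) that .
    fix V f assume V: "open V" "V \<subseteq> U" and f: "smooth_fun A V f"
    define F where "F y = frechet_derivative (f \<circ> inv_into U c) (at y) w" for y
    show "smooth_fun A V (\<lambda>q. chart_vec A U c q w f)"
    proof (rule smooth_funI)
      fix k V' d assume V': "(V', d) \<in> A"
      \<comment> \<open>One order of differentiability is spent on the derivative in
        \<open>F\<close>, hence \<open>Suc k\<close>.\<close>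
      have "Ck_on k (c ` (V \<inter> U)) F"
        using smooth_funD[OF f U(1), of "Suc k"] unfolding F_def by simp
      moreover have "Ck_on k (d ` (V \<inter> V')) (c \<circ> inv_into V' d)"
        using transition_smooth[OF V' U(1)] V(2) unfolding smooth_on_def by (blast intro: Ck_on_subset)
      moreover have "(c \<circ> inv_into V' d) ` d ` (V \<inter> V') \<subseteq> c ` (V \<inter> U)"
        using V' V(2) by auto
      ultimately have F: "Ck_on k (d ` (V \<inter> V')) (\<lambda>x. F ((c \<circ> inv_into V' d) x))"
        by (rule Ck_on_compose[OF chart_image_open[OF V' V(1)]])
      have "F ((c \<circ> inv_into V' d) x) = ((\<lambda>q. chart_vec A U c q w f) \<circ> inv_into V' d) x"
        if "x \<in> d ` (V \<inter> V')" for x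
        using that V' smooth_nearI[OF V(1) _ f] by (auto simp: F_def chart_vec_def)
      then show "Ck_on k (d ` (V \<inter> V')) ((\<lambda>q. chart_vec A U c q w f) \<circ> inv_into V' d)"
        by (rule Ck_on_cong[OF chart_image_open[OF V' V(1)], THEN iffD1, OF _ F])
    qed
  qed
  then show ?thesis
    using that chart_open[OF U(1)] U(2) w by blast
qed

end

section \<open>Algebra of a paracontact metric structure\<close>

locale paracontact_manifold = smooth_manifold A
  for A :: "'m::t2_space atlas" +
  fixes \<phi> :: "'m tensor11" and \<xi> :: "'m vfield" and \<eta> :: "'m form1" and g :: "'m bilin" and D :: "'m conn"
  assumes paracontact: "paracontact_metric A \<phi> \<xi> \<eta> g"
    and lc: "levi_civita A g D"
begin

abbreviation T where "T \<equiv> tangent_space A"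

lemma almost: "smooth_tensor11 A \<phi>" "smooth_vfield A UNIV \<xi>" "smooth_form1 A \<eta>" "metric21 A g"
  and phi_phi: "v \<in> T q \<Longrightarrow> \<phi> q (\<phi> q v) = v - \<eta> q v *\<^sub>T \<xi> q"
  and eta_xi [simp]: "\<eta> q (\<xi> q) = 1"
  and g_phi_phi: "u \<in> T q \<Longrightarrow> v \<in> T q \<Longrightarrow> g q (\<phi> q u) (\<phi> q v) = - g q u v + \<eta> q u * \<eta> q v"
  using paracontact unfolding paracontact_metric_def almost_paracontact_metric_def by blast+

lemma xi_smooth: "smooth_vfield A U \<xi>"
  using almost(2) smooth_vfield_subset by blast

lemma xi_in [simp]: "\<xi> q \<in> T q"
  using smooth_vfieldD(1)[OF almost(2)] by blast

lemma phi_in: "v \<in> T q \<Longrightarrow> \<phi> q v \<in> T q"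
  using almost(1) by (simp add: smooth_tensor11_def)

lemma phi_comb: "u \<in> T q \<Longrightarrow> v \<in> T q \<Longrightarrow> \<phi> q (a *\<^sub>T u + b *\<^sub>T v) = a *\<^sub>T \<phi> q u + b *\<^sub>T \<phi> q v"
  using almost(1) by (simp add: smooth_tensor11_def)

lemma phi_linear:
  "u \<in> T q \<Longrightarrow> v \<in> T q \<Longrightarrow> \<phi> q (u + v) = \<phi> q u + \<phi> q v"
  "u \<in> T q \<Longrightarrow> v \<in> T q \<Longrightarrow> \<phi> q (u - v) = \<phi> q u - \<phi> q v"
  "u \<in> T q \<Longrightarrow> \<phi> q (a *\<^sub>T u) = a *\<^sub>T \<phi> q u"
  "u \<in> T q \<Longrightarrow> \<phi> q (- u) = - \<phi> q u"
  using phi_comb[of u q v 1 1] phi_comb[of u q v 1 "- 1"] phi_comb[of u q u a 0] phi_comb[of u q u "- 1" 0]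
  by simp_all

lemma eta_comb: "u \<in> T q \<Longrightarrow> v \<in> T q \<Longrightarrow> \<eta> q (a *\<^sub>T u + b *\<^sub>T v) = a * \<eta> q u + b * \<eta> q v"
  using almost(3) by (simp add: smooth_form1_def)

lemma eta_scale: "u \<in> T q \<Longrightarrow> \<eta> q (a *\<^sub>T u) = a * \<eta> q u"
  using eta_comb[of u q u a 0] by (simp add: tscale_def plus_fun_def)

text \<open>By \<open>phi_phi\<close>, phi^2 xi = xi - xi = 0. The same identity at phi xi then
  makes phi xi a multiple k xi, and applying phi once more gives k^2 xi = 0, so k = 0.\<close>

lemma phi_xi [simp]: "\<phi> q (\<xi> q) = 0"
proof -
  have z: "a *\<^sub>T \<xi> q = 0 \<Longrightarrow> a = 0" for a
    using eta_scale[of "\<xi> q" q a] eta_scale[of "\<xi> q" q 0] by (simp add: tscale_def zero_fun_def)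
  have c: "\<phi> q (\<xi> q) \<in> T q" by (simp add: phi_in)
  have phi_zero: "\<phi> q 0 = 0"
    using phi_linear(3)[OF xi_in, where a = 0] by simp
  have 1: "\<phi> q (\<phi> q (\<xi> q)) = 0"
    by (simp add: phi_phi tscale_def fun_eq_iff)
  define k where "k = \<eta> q (\<phi> q (\<xi> q))"
  have k: "\<phi> q (\<xi> q) = k *\<^sub>T \<xi> q"
    using phi_phi[OF c] phi_zero 1 unfolding k_def by simp
  have "0 = \<phi> q (k *\<^sub>T \<xi> q)"
    using 1 unfolding k by simp
  also have "\<dots> = k *\<^sub>T (k *\<^sub>T \<xi> q)"
    using phi_linear(3)[OF xi_in] k by simp
  also have "\<dots> = (k * k) *\<^sub>T \<xi> q"
    by (simp add: tscale_def mult.assoc)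
  finally have "k * k = 0"
    using z by metis
  then show ?thesis
    unfolding k by (simp add: tscale_def fun_eq_iff)
qed

lemma g_sym: "u \<in> T q \<Longrightarrow> v \<in> T q \<Longrightarrow> g q u v = g q v u"
  using almost(4) by (simp add: metric21_def)

lemma g_comb: "u \<in> T q \<Longrightarrow> v \<in> T q \<Longrightarrow> w \<in> T q \<Longrightarrow> g q (a *\<^sub>T u + b *\<^sub>T v) w = a * g q u w + b * g q v w"
  using almost(4) by (simp add: metric21_def)

lemma g_left:
  "u \<in> T q \<Longrightarrow> v \<in> T q \<Longrightarrow> w \<in> T q \<Longrightarrow> g q (u + v) w = g q u w + g q v w"
  "u \<in> T q \<Longrightarrow> v \<in> T q \<Longrightarrow> w \<in> T q \<Longrightarrow> g q (u - v) w = g q u w - g q v w"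
  "u \<in> T q \<Longrightarrow> w \<in> T q \<Longrightarrow> g q (a *\<^sub>T u) w = a * g q u w"
  "u \<in> T q \<Longrightarrow> w \<in> T q \<Longrightarrow> g q (- u) w = - g q u w"
  "w \<in> T q \<Longrightarrow> g q 0 w = 0"
  using g_comb[of u q v w 1 1] g_comb[of u q v w 1 "- 1"] g_comb[of u q u w a 0] g_comb[of u q u w "- 1" 0]
    g_comb[of w q w w 0 0]
  by simp_all

lemma g_right:
  "u \<in> T q \<Longrightarrow> v \<in> T q \<Longrightarrow> w \<in> T q \<Longrightarrow> g q w (u + v) = g q w u + g q w v"
  "u \<in> T q \<Longrightarrow> v \<in> T q \<Longrightarrow> w \<in> T q \<Longrightarrow> g q w (u - v) = g q w u - g q w v"
  "u \<in> T q \<Longrightarrow> w \<in> T q \<Longrightarrow> g q w (a *\<^sub>T u) = a * g q w u"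
  "u \<in> T q \<Longrightarrow> w \<in> T q \<Longrightarrow> g q w (- u) = - g q w u"
  "w \<in> T q \<Longrightarrow> g q w 0 = 0"
  using g_left(1,2)[of u q v w] g_left(3)[of u q w a] g_left(4)[of u q w] g_left(5)[of w q] by (simp_all add: g_sym[of w q] tangent_space_closed)

text \<open>Put v = xi in the compatibility of g with phi: the left side vanishes since phi xi =
  0.\<close>

lemma g_xi: "u \<in> T q \<Longrightarrow> g q u (\<xi> q) = \<eta> q u"
  using g_phi_phi[of u q "\<xi> q"] g_right(5)[OF phi_in] by simp

text \<open>Compute phi^3 u in two ways: as phi^2 of phi u it is phi u - eta(phi u) xi, as phi of
  phi^2 u it is phi u.\<close>

lemma eta_phi:
  assumes "u \<in> T q"
  shows "\<eta> q (\<phi> q u) = 0"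
proof -
  have u: "\<phi> q u \<in> T q" "\<phi> q (\<phi> q u) \<in> T q" using assms phi_in by blast+
  have "\<eta> q (\<phi> q u) *\<^sub>T \<xi> q = \<phi> q u - \<phi> q (\<phi> q (\<phi> q u))"
    unfolding phi_phi[OF u(1)] by simp
  also have "\<dots> = \<phi> q (u - \<phi> q (\<phi> q u))"
    by (simp add: phi_linear assms u)
  also have "u - \<phi> q (\<phi> q u) = \<eta> q u *\<^sub>T \<xi> q"
    unfolding phi_phi[OF assms] by simp
  also have "\<phi> q (\<eta> q u *\<^sub>T \<xi> q) = 0"
    by (simp add: phi_linear(3)[OF xi_in])
  \<comment> \<open>Zero is written as a multiple of xi so that \<open>eta_scale\<close> evaluates
    both sides.\<close>
  finally have "\<eta> q (\<eta> q (\<phi> q u) *\<^sub>T \<xi> q) = \<eta> q (0 *\<^sub>T \<xi> q)"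
    by simp
  then show ?thesis by (simp add: eta_scale del: tscale_simps)
qed

text \<open>Replace v by phi v in \<open>g_phi_phi\<close>; the xi-part of phi^2 v contributes
  eta(phi u) = 0.\<close>

lemma g_phi_left:
  assumes "u \<in> T q" "v \<in> T q"
  shows "g q (\<phi> q u) v = - g q u (\<phi> q v)"
proof -
  have "g q (\<phi> q u) (\<phi> q (\<phi> q v)) = - g q u (\<phi> q v)"
    using g_phi_phi[OF assms(1) phi_in[OF assms(2)]] eta_phi[OF assms(2)] by simp
  then show ?thesis
    using assms by (simp add: phi_phi g_right tangent_space_closed phi_in g_xi eta_phi)
qed

lemma g_nondegenerate:
  assumes u: "u \<in> T q" and 0: "\<And>v. v \<in> T q \<Longrightarrow> g q u v = 0"
  shows "u = 0"
proof -
  obtain e1 e2 e3 where e: "tangent_basis A q e1 e2 e3"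
    "g q e1 e1 = 1" "g q e2 e2 = 1" "g q e3 e3 = - 1" "g q e1 e2 = 0" "g q e1 e3 = 0" "g q e2 e3 = 0"
    using almost(4) unfolding metric21_def by metis
  then have T: "e1 \<in> T q" "e2 \<in> T q" "e3 \<in> T q"
    unfolding tangent_basis_def by blast+
  obtain a b c where abc: "u = a *\<^sub>T e1 + b *\<^sub>T e2 + c *\<^sub>T e3"
    using e(1) u unfolding tangent_basis_def by blast
  have "a = 0" "b = 0" "c = 0"
    using 0[OF T(1)] 0[OF T(2)] 0[OF T(3)] e g_sym[OF T(1,2)] g_sym[OF T(1,3)] g_sym[OF T(2,3)] T
    unfolding abc by (simp_all add: g_left tangent_space_closed)
  then show ?thesis by (simp add: abc tscale_def fun_eq_iff)
qed

section \<open>Null pairs of eigenvectors: Artin frames at a point\<close>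

definition null_pair where
  "null_pair q u v \<longleftrightarrow> u \<in> T q \<and> v \<in> T q \<and> \<phi> q u = u \<and> \<phi> q v = - v \<and> g q u v = 1"

text \<open>Since eta vanishes on the image of phi and phi is skew, eigenvectors for 1 and -1 are
  orthogonal to xi and isotropic. This is why \<open>null_pair\<close> need not ask for either
  property.\<close>

lemma eigen_null:
  assumes "u \<in> T q" "\<phi> q u = u \<or> \<phi> q u = - u"
  shows "\<eta> q u = 0" "g q u u = 0"
proof -
  have "\<eta> q (- u) = - \<eta> q u"
    using eta_scale[OF assms(1), of "- 1"] by (simp add: tscale_def fun_Compl_def)
  then show "\<eta> q u = 0"
    using eta_phi[OF assms(1)] assms(2) by auto
  show "g q u u = 0"
    using g_phi_left[OF assms(1,1)] assms g_left(4)[OF assms(1,1)] g_right(4)[OF assms(1,1)] by auto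
qed

lemma null_pairD:
  assumes "null_pair q u v"
  shows "u \<in> T q" "v \<in> T q" "\<phi> q u = u" "\<phi> q v = - v" "g q u v = 1" "g q v u = 1"
    "g q u u = 0" "g q v v = 0" "g q (\<xi> q) u = 0" "g q (\<xi> q) v = 0" "g q u (\<xi> q) = 0" "g q v (\<xi> q) = 0"
    "g q (\<xi> q) (\<xi> q) = 1" "\<eta> q u = 0" "\<eta> q v = 0"
  using assms eigen_null[of u q] eigen_null[of v q] g_xi[of u q] g_xi[of v q] g_xi[of "\<xi> q" q]
    g_sym[of u q "\<xi> q"] g_sym[of v q "\<xi> q"] g_sym[of u q v]
  unfolding null_pair_def by simp_all

text \<open>The Gram determinant of \<open>\<xi>, u, v\<close> is \<open>- 1\<close>, so the coordinate matrix of these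
  vectors in a pseudo-orthonormal basis is invertible.\<close>

lemma null_pair_zeroI:
  assumes uv: "null_pair q u v" and w: "w \<in> T q"
    and 0: "g q w (\<xi> q) = 0" "g q w u = 0" "g q w v = 0"
  shows "w = 0"
proof -
  obtain e1 e2 e3 where e: "tangent_basis A q e1 e2 e3"
    "g q e1 e1 = 1" "g q e2 e2 = 1" "g q e3 e3 = - 1" "g q e1 e2 = 0" "g q e1 e3 = 0" "g q e2 e3 = 0"
    using almost(4) unfolding metric21_def by metis
  then have T: "e1 \<in> T q" "e2 \<in> T q" "e3 \<in> T q"
    unfolding tangent_basis_def by blast+
  have ex: "\<exists>a b c. z = a *\<^sub>T e1 + b *\<^sub>T e2 + c *\<^sub>T e3" if "z \<in> T q" for z
    using e(1) that unfolding tangent_basis_def by blast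
  obtain x1 x2 x3 where x: "\<xi> q = x1 *\<^sub>T e1 + x2 *\<^sub>T e2 + x3 *\<^sub>T e3" using ex[OF xi_in] by blast
  obtain u1 u2 u3 where u: "u = u1 *\<^sub>T e1 + u2 *\<^sub>T e2 + u3 *\<^sub>T e3" using ex null_pairD(1)[OF uv] by blast
  obtain v1 v2 v3 where v: "v = v1 *\<^sub>T e1 + v2 *\<^sub>T e2 + v3 *\<^sub>T e3" using ex null_pairD(2)[OF uv] by blast
  obtain w1 w2 w3 where w': "w = w1 *\<^sub>T e1 + w2 *\<^sub>T e2 + w3 *\<^sub>T e3" using ex w by blast
  have gg: "g q (a1 *\<^sub>T e1 + a2 *\<^sub>T e2 + a3 *\<^sub>T e3) (b1 *\<^sub>T e1 + b2 *\<^sub>T e2 + b3 *\<^sub>T e3)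
      = a1 * b1 + a2 * b2 - a3 * b3" for a1 a2 a3 b1 b2 b3
    using e g_sym[OF T(1,2)] g_sym[OF T(1,3)] g_sym[OF T(2,3)] T
    by (simp add: g_left g_right tangent_space_closed)
  have w0: "w1 * x1 + w2 * x2 - w3 * x3 = 0" "w1 * u1 + w2 * u2 - w3 * u3 = 0"
    "w1 * v1 + w2 * v2 - w3 * v3 = 0"
    using 0 unfolding x u v w' gg by auto
  have G: "x1 * x1 + x2 * x2 - x3 * x3 = 1" "u1 * u1 + u2 * u2 - u3 * u3 = 0"
    "v1 * v1 + v2 * v2 - v3 * v3 = 0" "x1 * u1 + x2 * u2 - x3 * u3 = 0"
    "x1 * v1 + x2 * v2 - x3 * v3 = 0" "u1 * v1 + u2 * v2 - u3 * v3 = 1"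
    using null_pairD[OF uv] unfolding x u v gg by auto
  \<comment> \<open>The determinant of the coordinates of xi, u, v. The next identity says that the
    Gram determinant, expanded along its first row, is -1 times d^2, where -1 is the determinant of
    the metric in the basis \<open>e1\<close>, \<open>e2\<close>, \<open>e3\<close>.\<close>
  define d where "d = x1 * (u2 * v3 - u3 * v2) - x2 * (u1 * v3 - u3 * v1) + x3 * (u1 * v2 - u2 * v1)"
  have "- (d * d) = (x1 * x1 + x2 * x2 - x3 * x3) * ((u1 * u1 + u2 * u2 - u3 * u3) * (v1 * v1 + v2 * v2 - v3 * v3)
      - (u1 * v1 + u2 * v2 - u3 * v3) * (u1 * v1 + u2 * v2 - u3 * v3))
    - (x1 * u1 + x2 * u2 - x3 * u3) * ((x1 * u1 + x2 * u2 - x3 * u3) * (v1 * v1 + v2 * v2 - v3 * v3)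
      - (u1 * v1 + u2 * v2 - u3 * v3) * (x1 * v1 + x2 * v2 - x3 * v3))
    + (x1 * v1 + x2 * v2 - x3 * v3) * ((x1 * u1 + x2 * u2 - x3 * u3) * (u1 * v1 + u2 * v2 - u3 * v3)
      - (u1 * u1 + u2 * u2 - u3 * u3) * (x1 * v1 + x2 * v2 - x3 * v3))"
    unfolding d_def by algebra
  then have "d \<noteq> 0" unfolding G by auto
  \<comment> \<open>Cramer's rule for the homogeneous system \<open>w0\<close>.\<close>
  moreover have "d * w1 = 0" "d * w2 = 0" "d * w3 = 0"
    using w0 unfolding d_def by algebra+
  ultimately show ?thesis
    unfolding w' by (simp add: tscale_def fun_eq_iff)
qed

lemma null_pair_eqI:
  assumes "null_pair q u v" "w \<in> T q" "z \<in> T q"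
    and "g q w (\<xi> q) = g q z (\<xi> q)" "g q w u = g q z u" "g q w v = g q z v"
  shows "w = z"
proof -
  have "w - z = 0"
    using assms by (intro null_pair_zeroI[OF assms(1)])
      (simp_all add: tangent_space_closed g_left null_pairD[OF assms(1)])
  then show ?thesis by simp
qed

text \<open>As u and v are isotropic with g(u, v) = 1, each is dual to the other: the coefficient of
  u is the product with v.\<close>

lemma null_pair_expand:
  assumes "null_pair q u v" "z \<in> T q"
  shows "z = g q z (\<xi> q) *\<^sub>T \<xi> q + g q z v *\<^sub>T u + g q z u *\<^sub>T v"
  by (rule null_pair_eqI[OF assms])
    (simp_all add: tangent_space_closed g_left null_pairD[OF assms(1)])

lemma null_pair_tangent_basis:
  assumes uv: "null_pair q u v"
  shows "tangent_basis A q (\<xi> q) u v"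
  unfolding tangent_basis_def
proof (intro conjI ballI)
  fix z assume z: "z \<in> T q"
  have "a = g q z (\<xi> q) \<and> b = g q z v \<and> c = g q z u"
    if "z = a *\<^sub>T \<xi> q + b *\<^sub>T u + c *\<^sub>T v" for a b c
    unfolding that by (simp add: tangent_space_closed g_left null_pairD[OF uv])
  then show "\<exists>!(a, b, c). z = a *\<^sub>T \<xi> q + b *\<^sub>T u + c *\<^sub>T v"
    using null_pair_expand[OF uv z]
    by (intro ex1I[of _ "(g q z (\<xi> q), g q z v, g q z u)"]) auto
qed (use null_pairD[OF uv] in simp_all)

end

section \<open>The Levi-Civita connection and the operator \<open>h\<close>\<close>

context paracontact_manifold
begin

section \<open>Rules for covariant derivatives\<close>

lemma lc_affine: "affine_connection A D" "torsion_free A D" "metric_connection A g D"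
  using lc unfolding levi_civita_def by auto

lemma
  assumes "open U" "smooth_vfield A U Y" "q \<in> U"
  shows D_in: "v \<in> T q \<Longrightarrow> D q v Y \<in> T q"
    and D_comb: "u \<in> T q \<Longrightarrow> v \<in> T q \<Longrightarrow> D q (a *\<^sub>T u + b *\<^sub>T v) Y = a *\<^sub>T D q u Y + b *\<^sub>T D q v Y"
    and D_field_scale: "v \<in> T q \<Longrightarrow> smooth_fun A U f \<Longrightarrow>
      D q v (\<lambda>r. f r *\<^sub>T Y r) = v f *\<^sub>T Y q + f q *\<^sub>T D q v Y"
    and D_cong: "v \<in> T q \<Longrightarrow> (\<And>r. r \<in> U \<Longrightarrow> Z r = Y r) \<Longrightarrow> D q v Z = D q v Y"
proof -
  note * = lc_affine(1)[unfolded affine_connection_def, THEN conjunct1, THEN spec[where x = U],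
      THEN spec[where x = Y], THEN spec[where x = q], THEN mp, OF conjI[OF assms(1) conjI[OF assms(2,3)]]]
  show "v \<in> T q \<Longrightarrow> D q v Y \<in> T q"
    using *[THEN conjunct1] by blast
  show "u \<in> T q \<Longrightarrow> v \<in> T q \<Longrightarrow> D q (a *\<^sub>T u + b *\<^sub>T v) Y = a *\<^sub>T D q u Y + b *\<^sub>T D q v Y"
    using *[THEN conjunct2, THEN conjunct1] by blast
  show "v \<in> T q \<Longrightarrow> smooth_fun A U f \<Longrightarrow>
      D q v (\<lambda>r. f r *\<^sub>T Y r) = v f *\<^sub>T Y q + f q *\<^sub>T D q v Y"
    using *[THEN conjunct2, THEN conjunct2, THEN conjunct2, THEN conjunct1] by blast
  show "v \<in> T q \<Longrightarrow> (\<And>r. r \<in> U \<Longrightarrow> Z r = Y r) \<Longrightarrow> D q v Z = D q v Y"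
    using *[THEN conjunct2, THEN conjunct2, THEN conjunct2, THEN conjunct2] by blast
qed

lemma
  assumes "open U" "smooth_vfield A U Y" "q \<in> U"
  shows D_add: "u \<in> T q \<Longrightarrow> v \<in> T q \<Longrightarrow> D q (u + v) Y = D q u Y + D q v Y"
    and D_diff: "u \<in> T q \<Longrightarrow> v \<in> T q \<Longrightarrow> D q (u - v) Y = D q u Y - D q v Y"
    and D_scale: "u \<in> T q \<Longrightarrow> D q (a *\<^sub>T u) Y = a *\<^sub>T D q u Y"
  using D_comb[OF assms, of u v 1 1] D_comb[OF assms, of u v 1 "- 1"] D_comb[OF assms, of u u a 0]
  by simp_all

lemma cov_smooth:
  "open U \<Longrightarrow> smooth_vfield A U X \<Longrightarrow> smooth_vfield A U Y \<Longrightarrow> smooth_vfield A U (cov D X Y)"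
  using lc_affine(1)[unfolded affine_connection_def, THEN conjunct2] by simp

lemma bracket_eq:
  assumes "open U" "smooth_vfield A U X" "smooth_vfield A U Y" "q \<in> U"
  shows "lie_bracket A X Y q = D q (X q) Y - D q (Y q) X"
  using lc_affine(2)[unfolded torsion_free_def cov_def, THEN spec[where x = U], THEN spec[where x = X],
      THEN spec[where x = Y]] assms by simp

lemma metric_deriv:
  assumes "open U" "smooth_vfield A U X" "smooth_vfield A U Y" "smooth_vfield A U Z" "q \<in> U"
  shows "X q (\<lambda>r. g r (Y r) (Z r)) = g q (D q (X q) Y) (Z q) + g q (Y q) (D q (X q) Z)"
  using lc_affine(3)[unfolded metric_connection_def cov_def, THEN spec[where x = U], THEN spec[where x = X],
      THEN spec[where x = Y], THEN spec[where x = Z]] assms by simp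

lemma g_smooth:
  assumes "open U" "smooth_vfield A U X" "smooth_vfield A U Y"
  shows "smooth_fun A U (\<lambda>q. g q (X q) (Y q))"
  using almost(4) assms by (simp add: metric21_def)

text \<open>Metric compatibility, where the derivative of a constant scalar product drops out.
  Applied to the products of frame fields it makes the connection matrix skew.\<close>

lemma g_const_deriv:
  assumes "open U" "smooth_vfield A U X" "smooth_vfield A U Y" "smooth_vfield A U Z" "q \<in> U"
    and "\<And>r. r \<in> U \<Longrightarrow> g r (Y r) (Z r) = a"
  shows "g q (D q (X q) Y) (Z q) = - g q (Y q) (D q (X q) Z)"
proof -
  have X: "X q \<in> T q"
    using assms(2,5) smooth_vfieldD(1) by blast
  have "X q (\<lambda>r. g r (Y r) (Z r)) = X q (\<lambda>r. a)"
    by (rule tangent_vec_cong[OF X assms(1,5,6)])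
  then show ?thesis
    using metric_deriv[OF assms(1-5)] tangent_vec_const[OF X] by simp
qed

lemma g_D_xi_xi:
  assumes "open U" "smooth_vfield A U X" "q \<in> U"
  shows "g q (D q (X q) \<xi>) (\<xi> q) = 0"
proof -
  have "g q (D q (X q) \<xi>) (\<xi> q) = - g q (\<xi> q) (D q (X q) \<xi>)"
    using g_const_deriv[OF assms(1,2) xi_smooth xi_smooth assms(3)] g_xi eta_xi xi_in by metis
  moreover have "D q (X q) \<xi> \<in> T q"
    using D_in[OF assms(1) xi_smooth assms(3)] smooth_vfieldD(1)[OF assms(2,3)] .
  ultimately show ?thesis
    using g_sym[of "\<xi> q" q "D q (X q) \<xi>"] by simp
qed

text \<open>With eta(X) and eta(Y) constant, only the bracket term of d eta survives; the factor 1/2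
  in \<open>ext_deriv\<close> becomes the 2 here, and the bracket is rewritten by vanishing
  torsion.\<close>

lemma eta_bracket:
  assumes "open U" "smooth_vfield A U X" "smooth_vfield A U Y" "q \<in> U"
    and "\<And>r. r \<in> U \<Longrightarrow> \<eta> r (X r) = a" "\<And>r. r \<in> U \<Longrightarrow> \<eta> r (Y r) = b"
  shows "\<eta> q (D q (X q) Y - D q (Y q) X) = - 2 * g q (X q) (\<phi> q (Y q))"
proof -
  have T: "X q \<in> T q" "Y q \<in> T q"
    using assms(2-4) smooth_vfieldD(1) by blast+
  have "X q (\<lambda>r. \<eta> r (Y r)) = X q (\<lambda>r. b)"
    by (rule tangent_vec_cong[OF T(1) assms(1,4,6)])
  moreover have "Y q (\<lambda>r. \<eta> r (X r)) = Y q (\<lambda>r. a)"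
    by (rule tangent_vec_cong[OF T(2) assms(1,4,5)])
  moreover have "ext_deriv A \<eta> X Y q = fundamental_form \<phi> g q (X q) (Y q)"
    using paracontact[unfolded paracontact_metric_def, THEN conjunct2, THEN spec[where x = U],
      THEN spec[where x = X], THEN spec[where x = Y]] assms(1-4) by simp
  ultimately show ?thesis
    using tangent_vec_const[OF T(1), of b] tangent_vec_const[OF T(2), of a]
    unfolding ext_deriv_def fundamental_form_def bracket_eq[OF assms(1-4)] by simp
qed

section \<open>The bracket with xi and the operator h\<close>

definition xi_bracket where "xi_bracket X q = D q (\<xi> q) X - D q (X q) \<xi>"

lemma xi_bracket_in:
  assumes "open U" "smooth_vfield A U X" "q \<in> U"
  shows "xi_bracket X q \<in> T q"
  unfolding xi_bracket_def
  using assms D_in[OF assms] D_in[OF assms(1) xi_smooth assms(3)] smooth_vfieldD(1)[OF assms(2,3)]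
  by (simp add: tangent_space_closed)

lemma xi_bracket_smooth:
  assumes "open U" "smooth_vfield A U X"
  shows "smooth_vfield A U (xi_bracket X)"
  using smooth_vfield_diff[OF assms(1) cov_smooth[OF assms(1) xi_smooth assms(2)] cov_smooth[OF assms xi_smooth]]
  unfolding cov_def xi_bracket_def .

text \<open>By vanishing torsion, \<open>xi_bracket X\<close> is [xi, X] on \<open>U\<close>. The
  contact condition equates its eta-value with -2 g(xi, phi X), which is 0 as phi is skew and kills
  xi.\<close>

lemma eta_xi_bracket:
  assumes "open U" "smooth_vfield A U X" "q \<in> U" "\<And>r. r \<in> U \<Longrightarrow> \<eta> r (X r) = 0"
  shows "\<eta> q (xi_bracket X q) = 0"
proof -
  have X: "X q \<in> T q" using assms(2,3) smooth_vfieldD(1) by blast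
  have "g q (\<xi> q) (\<phi> q (X q)) = 0"
    using g_phi_left[of "\<xi> q" q "X q"] X g_left(5)[OF X] by simp
  then show ?thesis
    unfolding xi_bracket_def using eta_bracket[OF assms(1) xi_smooth assms(2,3) eta_xi assms(4)] by simp
qed

text \<open>Near q the field phi X may be replaced by s X inside the bracket, and the constant s
  pulled out.\<close>

lemma h_op_eigen:
  assumes "open U" "smooth_vfield A U X" "q \<in> U" "\<And>r. r \<in> U \<Longrightarrow> \<phi> r (X r) = s *\<^sub>T X r"
  shows "h_op A \<phi> \<xi> X q = (1 / 2) *\<^sub>T (s *\<^sub>T xi_bracket X q - \<phi> q (xi_bracket X q))"
proof -
  have sX: "smooth_vfield A U (\<lambda>r. s *\<^sub>T X r)"
    by (rule smooth_vfield_scale[OF assms(1) smooth_fun_const assms(2)])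
  have aX: "smooth_vfield A U (app \<phi> X)"
    using sX by (rule smooth_vfield_cong[OF assms(1), rotated]) (simp add: app_def assms(4))
  have X: "X q \<in> T q" using assms(2,3) smooth_vfieldD(1) by blast
  have "D q (\<xi> q) (app \<phi> X) = D q (\<xi> q) (\<lambda>r. s *\<^sub>T X r)"
    by (rule D_cong[OF assms(1) sX assms(3) xi_in]) (simp add: app_def assms(4))
  also have "\<dots> = s *\<^sub>T D q (\<xi> q) X"
    using D_field_scale[OF assms(1-3) xi_in smooth_fun_const] tangent_vec_const[OF xi_in] by simp
  finally have "lie_bracket A \<xi> (app \<phi> X) q = s *\<^sub>T xi_bracket X q"
    unfolding bracket_eq[OF assms(1) xi_smooth aX assms(3)] xi_bracket_def
    by (simp add: app_def assms(3,4) D_scale[OF assms(1) xi_smooth assms(3) X])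
      (simp add: tscale_def fun_eq_iff algebra_simps)
  then show ?thesis
    unfolding h_op_def bracket_eq[OF assms(1) xi_smooth assms(2,3)] xi_bracket_def by simp
qed

text \<open>[xi, X] lies in the kernel of eta, where phi^2 is the identity and (1 - phi)/2 is the
  projection onto the -1 eigenspace. So h maps +1 eigenfields to -1 eigenfields.\<close>

lemma
  assumes "open U" "smooth_vfield A U X" "\<And>r. r \<in> U \<Longrightarrow> \<phi> r (X r) = X r"
  shows phi_h_op: "q \<in> U \<Longrightarrow> \<phi> q (h_op A \<phi> \<xi> X q) = - h_op A \<phi> \<xi> X q"
    and h_op_in: "q \<in> U \<Longrightarrow> h_op A \<phi> \<xi> X q \<in> T q"
    and h_op_smooth: "smooth_vfield A U (h_op A \<phi> \<xi> X)"
proof -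
  have h: "h_op A \<phi> \<xi> X q = (1 / 2) *\<^sub>T (xi_bracket X q - \<phi> q (xi_bracket X q))" if "q \<in> U" for q
    using h_op_eigen[OF assms(1,2) that, of 1] assms(3) by simp
  have B: "xi_bracket X q \<in> T q" if "q \<in> U" for q
    using xi_bracket_in[OF assms(1,2) that] .
  have e: "\<eta> q (xi_bracket X q) = 0" if "q \<in> U" for q
    using eta_xi_bracket[OF assms(1,2) that] eigen_null(1) smooth_vfieldD(1)[OF assms(2)] assms(3) by metis
  show "\<phi> q (h_op A \<phi> \<xi> X q) = - h_op A \<phi> \<xi> X q" if "q \<in> U"
    unfolding h[OF that] using B[OF that]
    by (simp add: phi_linear tangent_space_closed phi_in phi_phi e[OF that])
      (simp add: tscale_def fun_eq_iff algebra_simps)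
  show "h_op A \<phi> \<xi> X q \<in> T q" if "q \<in> U"
    unfolding h[OF that] using B[OF that] by (simp add: tangent_space_closed phi_in)
  have "smooth_vfield A U (app \<phi> (xi_bracket X))"
    using almost(1) assms(1) xi_bracket_smooth[OF assms(1,2)] by (simp add: smooth_tensor11_def)
  then have "smooth_vfield A U (\<lambda>q. (1 / 2) *\<^sub>T (xi_bracket X q - \<phi> q (xi_bracket X q)))"
    unfolding app_def
    by (intro smooth_vfield_scale smooth_vfield_diff xi_bracket_smooth smooth_fun_const assms(1,2))
  then show "smooth_vfield A U (h_op A \<phi> \<xi> X)"
    by (rule smooth_vfield_cong[OF assms(1), rotated]) (simp add: h)
qed

text \<open>[xi, f Z] = xi(f) Z + f [xi, Z], and the projection (1 - phi)/2 annihilates Z. This much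
  linearity over functions suffices to normalise the frame.\<close>

lemma h_op_scale:
  assumes "open U" "smooth_vfield A U Z" "\<And>r. r \<in> U \<Longrightarrow> \<phi> r (Z r) = Z r" "smooth_fun A U f"
    and "q \<in> U" "\<And>r. r \<in> U \<Longrightarrow> X r = f r *\<^sub>T Z r"
  shows "h_op A \<phi> \<xi> X q = f q *\<^sub>T h_op A \<phi> \<xi> Z q"
proof -
  have fZ: "smooth_vfield A U (\<lambda>r. f r *\<^sub>T Z r)"
    by (rule smooth_vfield_scale[OF assms(1,4,2)])
  have X: "smooth_vfield A U X"
    using fZ by (rule smooth_vfield_cong[OF assms(1), rotated]) (simp add: assms(6))
  have ZT: "Z r \<in> T r" if "r \<in> U" for r using assms(2) that smooth_vfieldD(1) by blast
  have B: "xi_bracket Z q \<in> T q"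
    using xi_bracket_in[OF assms(1,2,5)] .
  have "D q (\<xi> q) X = \<xi> q f *\<^sub>T Z q + f q *\<^sub>T D q (\<xi> q) Z"
    using D_cong[OF assms(1) fZ assms(5) xi_in assms(6)] D_field_scale[OF assms(1,2,5) xi_in assms(4)] by simp
  then have b: "xi_bracket X q = \<xi> q f *\<^sub>T Z q + f q *\<^sub>T xi_bracket Z q"
    unfolding xi_bracket_def assms(6)[OF assms(5)] D_scale[OF assms(1) xi_smooth assms(5) ZT[OF assms(5)]]
    by (simp add: tscale_def fun_eq_iff algebra_simps)
  have "h_op A \<phi> \<xi> X q = (1 / 2) *\<^sub>T (xi_bracket X q - \<phi> q (xi_bracket X q))"
    using h_op_eigen[OF assms(1) X assms(5), of 1] assms(3,6) ZT phi_linear(3) by simp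
  moreover have "h_op A \<phi> \<xi> Z q = (1 / 2) *\<^sub>T (xi_bracket Z q - \<phi> q (xi_bracket Z q))"
    using h_op_eigen[OF assms(1,2,5), of 1] assms(3) by simp
  ultimately show ?thesis
    unfolding b using B ZT[OF assms(5)] assms(3)[OF assms(5)]
    by (simp add: phi_linear tangent_space_closed) (simp add: tscale_def fun_eq_iff algebra_simps)
qed

section \<open>Existence of a frame adapted to h\<close>

lemma g_eigen_orthogonal:
  assumes "u \<in> T q" "v \<in> T q" "\<phi> q u = u" "\<phi> q v = v"
  shows "g q u v = 0"
  using g_phi_left[OF assms(1,2)] assms(3,4) by simp

text \<open>It is not clear beforehand that \<open>X\<close> has no zero at \<open>p\<close>, since \<open>h_op\<close> is an operator on
  fields. An eigenvector field \<open>Z\<close> with \<open>g(Z, h X) \<noteq> 0\<close> satisfies \<open>g(Z, h X) X = g(X, h X) Z\<close>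
  near \<open>p\<close>, and applying \<open>h\<close> shows that \<open>g(X, h X)\<close> does not vanish there.\<close>

lemma g_h_op_nonzero:
  assumes W: "open W" "p \<in> W" and X: "smooth_vfield A W X" "\<And>r. r \<in> W \<Longrightarrow> \<phi> r (X r) = X r"
    and h: "h_op A \<phi> \<xi> X p \<noteq> 0"
  shows "g p (X p) (h_op A \<phi> \<xi> X p) \<noteq> 0"
proof -
  define Y where "Y = h_op A \<phi> \<xi> X"
  have Y: "smooth_vfield A W Y" "\<And>r. r \<in> W \<Longrightarrow> Y r \<in> T r" "\<And>r. r \<in> W \<Longrightarrow> \<phi> r (Y r) = - Y r"
    unfolding Y_def by (simp_all add: h_op_smooth[OF W(1) X] h_op_in[OF W(1) X] phi_h_op[OF W(1) X])
  obtain v where v: "v \<in> T p" "g p (Y p) v \<noteq> 0"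
    using g_nondegenerate[OF Y(2)[OF W(2)]] h unfolding Y_def by blast
  obtain U V where U: "open U" "p \<in> U" and V: "smooth_vfield A U V" "V p = v"
    using tangent_vec_extend[OF v(1)] .
  \<comment> \<open>(phi^2 + phi)/2 is the projection onto the +1 eigenspace; applied to the smooth
    field \<open>V\<close> it gives a smooth field.\<close>
  define Z where "Z r = (1 / 2) *\<^sub>T (app \<phi> (app \<phi> V) r + app \<phi> V r)" for r
  have VT: "V r \<in> T r" if "r \<in> U" for r using V(1) that smooth_vfieldD(1) by blast
  have appV: "smooth_vfield A U (app \<phi> V)" "smooth_vfield A U (app \<phi> (app \<phi> V))"
    using almost(1) U(1) V(1) by (simp_all add: smooth_tensor11_def)
  have Zs: "smooth_vfield A U Z"
    unfolding Z_def by (intro smooth_vfield_scale smooth_vfield_add smooth_fun_const appV U(1))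
  have ZT: "Z r \<in> T r" if "r \<in> U" for r using Zs that smooth_vfieldD(1) by blast
  have Zphi: "\<phi> r (Z r) = Z r" if "r \<in> U" for r
    unfolding Z_def app_def using VT[OF that]
    by (simp add: phi_linear tangent_space_closed phi_in phi_phi[of "\<phi> r (V r)"] eta_phi)
      (simp add: tscale_def fun_eq_iff)
  \<comment> \<open>\<open>Y\<close> is a -1 eigenfield and phi is skew, so the projection to
    \<open>Z\<close> does not change the product with \<open>Y\<close>.\<close>
  have "g p (Y p) (\<phi> p (V p)) = g p (Y p) (V p)"
    using g_phi_left[OF Y(2) VT, of p] Y(3)[OF W(2)] W(2) U(2) g_left(4)[OF Y(2) VT, of p] by simp
  moreover from this have "g p (Y p) (\<phi> p (\<phi> p (V p))) = g p (Y p) (V p)"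
    using g_phi_left[OF Y(2) phi_in[OF VT], of p] Y(3)[OF W(2)] W(2) U(2)
      g_left(4)[OF Y(2) phi_in[OF VT], of p] by simp
  ultimately have "g p (Z p) (Y p) \<noteq> 0"
    using v(2) V(2) Y(2)[OF W(2)] VT[OF U(2)] unfolding Z_def app_def
    by (simp add: g_left g_sym[of _ p "Y p"] tangent_space_closed phi_in)
  define N where "N = {r \<in> U \<inter> W. g r (Z r) (Y r) \<in> - {0}}"
  have UW: "open (U \<inter> W)" using U W by blast
  have ZY: "smooth_fun A (U \<inter> W) (\<lambda>r. g r (Z r) (Y r))"
    by (intro g_smooth UW smooth_vfield_subset[OF Zs] smooth_vfield_subset[OF Y(1)]) auto
  have N: "open N" "p \<in> N" "N \<subseteq> U" "N \<subseteq> W"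
    using continuous_open_preimage[OF smooth_fun_continuous[OF UW ZY] UW, of "- {0}"]
      \<open>g p (Z p) (Y p) \<noteq> 0\<close> U W unfolding N_def vimage_def Int_def by auto
  note sN = smooth_vfield_subset[OF Zs N(3)] smooth_vfield_subset[OF Y(1) N(4)] smooth_vfield_subset[OF X(1) N(4)]
  have eq: "g r (Z r) (Y r) *\<^sub>T X r = g r (X r) (Y r) *\<^sub>T Z r" if "r \<in> N" for r
  proof -
    have r: "r \<in> U" "r \<in> W" "g r (Z r) (Y r) \<noteq> 0" using that unfolding N_def by auto
    have XT: "X r \<in> T r" using X(1) r smooth_vfieldD(1) by blast
    \<comment> \<open>Where g(Z, Y) is nonzero, a multiple of \<open>Y\<close> completes
      \<open>Z\<close> to a null pair, so \<open>eq\<close> can be checked on scalar products; only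
      the product with \<open>Y\<close> is nontrivial.\<close>
    have nz: "null_pair r (Z r) ((1 / g r (Z r) (Y r)) *\<^sub>T Y r)"
      unfolding null_pair_def using r ZT Zphi Y(2,3)
      by (auto simp: tangent_space_closed phi_linear g_right) (simp add: tscale_def fun_eq_iff)
    show ?thesis
    proof (rule null_pair_eqI[OF nz])
      show "g r (g r (Z r) (Y r) *\<^sub>T X r) (\<xi> r) = g r (g r (X r) (Y r) *\<^sub>T Z r) (\<xi> r)"
        using XT ZT[OF r(1)] X(2)[OF r(2)] Zphi[OF r(1)] by (simp add: g_left g_xi eigen_null)
      show "g r (g r (Z r) (Y r) *\<^sub>T X r) (Z r) = g r (g r (X r) (Y r) *\<^sub>T Z r) (Z r)"
        using XT ZT[OF r(1)] X(2)[OF r(2)] Zphi[OF r(1)] by (simp add: g_left g_eigen_orthogonal)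
    qed (use XT ZT[OF r(1)] Y(2)[OF r(2)] in \<open>simp_all add: g_left g_right tangent_space_closed\<close>)
  qed
  \<comment> \<open>The two multiples in \<open>eq\<close> agree on all of \<open>N\<close> and not
    merely at p, as an operator on fields requires.\<close>
  have "g p (Z p) (Y p) *\<^sub>T h_op A \<phi> \<xi> X p = h_op A \<phi> \<xi> (\<lambda>r. g r (Z r) (Y r) *\<^sub>T X r) p"
    by (rule h_op_scale[symmetric, OF N(1) sN(3) _ g_smooth[OF N(1) sN(1,2)] N(2)]) (use X(2) N(4) in auto)
  also have "\<dots> = g p (X p) (Y p) *\<^sub>T h_op A \<phi> \<xi> Z p"
    by (rule h_op_scale[OF N(1) sN(1) _ g_smooth[OF N(1) sN(3,2)] N(2)]) (use Zphi N(3) eq in auto)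
  finally have "g p (X p) (Y p) = 0 \<Longrightarrow> g p (Z p) (Y p) *\<^sub>T h_op A \<phi> \<xi> X p = 0"
    by simp
  then show ?thesis
    using \<open>g p (Z p) (Y p) \<noteq> 0\<close> h unfolding Y_def by (auto simp: tscale_def fun_eq_iff)
qed

lemma h_adapted_frame_exists:
  assumes W: "open W" "p \<in> W" and X: "smooth_vfield A W X" "\<And>r. r \<in> W \<Longrightarrow> \<phi> r (X r) = X r"
    and h: "\<And>r. r \<in> W \<Longrightarrow> h_op A \<phi> \<xi> X r \<noteq> 0"
  obtains U E1 E2 and \<epsilon> :: real where "open U" "p \<in> U" "\<epsilon> \<in> {1, - 1}"
    "smooth_vfield A U E1" "smooth_vfield A U E2"
    "\<And>r. r \<in> U \<Longrightarrow> null_pair r (E1 r) (E2 r)"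
    "\<And>r. r \<in> U \<Longrightarrow> h_op A \<phi> \<xi> E1 r = \<epsilon> *\<^sub>T E2 r"
proof -
  define Y where "Y = h_op A \<phi> \<xi> X"
  have Y: "smooth_vfield A W Y" "\<And>r. r \<in> W \<Longrightarrow> Y r \<in> T r" "\<And>r. r \<in> W \<Longrightarrow> \<phi> r (Y r) = - Y r"
    unfolding Y_def by (simp_all add: h_op_smooth[OF W(1) X] h_op_in[OF W(1) X] phi_h_op[OF W(1) X])
  define \<rho> where "\<rho> r = g r (X r) (Y r)" for r
  \<comment> \<open>The sign has to be constant, so \<open>U\<close> below keeps only the points
    where \<rho> has the sign that it has at p; there the base of the power in \<open>f\<close> is
    positive.\<close>
  define \<epsilon> where "\<epsilon> = sgn (\<rho> p)"
  have \<rho>: "smooth_fun A W (\<lambda>r. \<epsilon> * \<rho> r)"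
    unfolding \<rho>_def by (intro smooth_fun_mult smooth_fun_const g_smooth W(1) X(1) Y(1))
  have "\<rho> p \<noteq> 0"
    unfolding \<rho>_def Y_def by (rule g_h_op_nonzero[OF W X h[OF W(2)]])
  then have \<epsilon>: "\<epsilon> \<in> {1, - 1}" "\<epsilon> * \<rho> p > 0" "\<epsilon> * \<epsilon> = 1"
    unfolding \<epsilon>_def by (auto simp: sgn_real_def)
  define U where "U = {r \<in> W. \<epsilon> * \<rho> r \<in> {0<..}}"
  have U: "open U" "p \<in> U" "U \<subseteq> W" "\<And>r. r \<in> U \<Longrightarrow> \<epsilon> * \<rho> r > 0"
    using continuous_open_preimage[OF smooth_fun_continuous[OF W(1) \<rho>] W(1), of "{0<..}"] W(2) \<epsilon>(2)
    unfolding U_def vimage_def Int_def by auto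
  define f where "f r = (\<epsilon> * \<rho> r) powr (- 1 / 2)" for r
  have f: "smooth_fun A U f"
    unfolding f_def using U by (intro smooth_fun_powr smooth_fun_subset[OF \<rho>]) auto
  have ff: "\<epsilon> * (f r * (f r * \<rho> r)) = 1" if "r \<in> U" for r
  proof -
    have "f r * f r = inverse (\<epsilon> * \<rho> r)"
      using U(4)[OF that] unfolding f_def powr_add[symmetric] by (simp add: powr_minus)
    then have "\<epsilon> * (f r * (f r * \<rho> r)) = inverse (\<epsilon> * \<rho> r) * (\<epsilon> * \<rho> r)"
      by (metis mult.assoc mult.left_commute)
    also have "\<dots> = 1"
      using U(4)[OF that] by (intro left_inverse) auto
    finally show ?thesis .
  qed
  define E1 where "E1 r = f r *\<^sub>T X r" for r
  \<comment> \<open>This factor makes g(E1, E2) = \<epsilon> f^2 \<rho> = 1, while h E1 = f Y equals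
    \<epsilon> E2 because \<epsilon>^2 = 1.\<close>
  define E2 where "E2 r = (\<epsilon> * f r) *\<^sub>T Y r" for r
  have XT: "X r \<in> T r" if "r \<in> W" for r using X(1) that smooth_vfieldD(1) by blast
  show ?thesis
  proof
    show "open U" "p \<in> U" "\<epsilon> \<in> {1, - 1}" by fact+
    show "smooth_vfield A U E1"
      unfolding E1_def by (intro smooth_vfield_scale f U(1) smooth_vfield_subset[OF X(1) U(3)])
    show "smooth_vfield A U E2"
      unfolding E2_def
      by (intro smooth_vfield_scale smooth_fun_mult smooth_fun_const f U(1) smooth_vfield_subset[OF Y(1) U(3)])
    fix r assume r: "r \<in> U"
    then have rW: "r \<in> W" using U(3) by blast
    show "null_pair r (E1 r) (E2 r)"
      unfolding null_pair_def E1_def E2_def using ff[OF r] XT[OF rW] Y(2,3)[OF rW] X(2)[OF rW]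
      by (auto simp: tangent_space_closed phi_linear g_left g_right \<rho>_def mult_ac)
        (simp add: tscale_def fun_eq_iff)
    have "h_op A \<phi> \<xi> E1 r = f r *\<^sub>T Y r"
      unfolding Y_def
      by (rule h_op_scale[OF U(1) smooth_vfield_subset[OF X(1) U(3)] _ f r]) (use X(2) U(3) in \<open>auto simp: E1_def\<close>)
    then show "h_op A \<phi> \<xi> E1 r = \<epsilon> *\<^sub>T E2 r"
      using \<epsilon>(3) by (simp add: E2_def tscale_def fun_eq_iff mult.assoc[symmetric])
  qed
qed

end

section \<open>The connection in a frame adapted to \<open>h\<close>\<close>

locale h_adapted_frame = paracontact_manifold A \<phi> \<xi> \<eta> g D
  for A :: "'m::t2_space atlas" and \<phi> \<xi> \<eta> g D +
  fixes U :: "'m set" and E1 E2 :: "'m vfield" and \<epsilon> \<kappa> \<mu> :: real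
  assumes kappa_mu: "kappa_mu_space A \<phi> \<xi> \<eta> D \<kappa> \<mu>"
    and U: "open U" and E1: "smooth_vfield A U E1" and E2: "smooth_vfield A U E2"
    and pair: "\<And>q. q \<in> U \<Longrightarrow> null_pair q (E1 q) (E2 q)"
    and h_E1: "\<And>q. q \<in> U \<Longrightarrow> h_op A \<phi> \<xi> E1 q = \<epsilon> *\<^sub>T E2 q"
    and eps: "\<epsilon> * \<epsilon> = 1"
begin

section \<open>Connection coefficients of the frame\<close>

lemmas xi = xi_smooth[of U]

text \<open>Skewness leaves three coefficients for each of three directions, nine in all. The
  equation for h E1 fixes one of them, and the two components of the derivative of xi along itself
  vanish; the six functions here are the rest.\<close>

definition m where "m q = g q (D q (\<xi> q) E1) (E2 q)"
definition B where "B q = g q (D q (E1 q) \<xi>) (E2 q)"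
definition C where "C q = g q (D q (E2 q) \<xi>) (E1 q)"
definition K where "K q = g q (D q (E2 q) \<xi>) (E2 q)"
definition b where "b q = g q (D q (E1 q) E1) (E2 q)"
definition b' where "b' q = g q (D q (E2 q) E1) (E2 q)"

context
  fixes q assumes q: "q \<in> U"
begin

lemmas frame = null_pairD[OF pair[OF q]]

lemmas D_frame_in =
  D_in[OF U E1 q frame(1)] D_in[OF U E1 q frame(2)] D_in[OF U E1 q xi_in]
  D_in[OF U E2 q frame(1)] D_in[OF U E2 q frame(2)] D_in[OF U E2 q xi_in]
  D_in[OF U xi q frame(1)] D_in[OF U xi q frame(2)] D_in[OF U xi q xi_in]

lemma E1_xi_bracket: "xi_bracket E1 q \<in> T q" "\<eta> q (xi_bracket E1 q) = 0"
  and E2_xi_bracket: "xi_bracket E2 q \<in> T q" "\<eta> q (xi_bracket E2 q) = 0"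
  using xi_bracket_in[OF U E1 q] xi_bracket_in[OF U E2 q]
    eta_xi_bracket[OF U E1 q null_pairD(14)[OF pair]] eta_xi_bracket[OF U E2 q null_pairD(15)[OF pair]]
  by simp_all

lemmas const = g_const_deriv[OF U _ _ _ q]

lemma g_D_swap:
  assumes "smooth_vfield A U X"
  shows "g q (D q (X q) E1) (\<xi> q) = - g q (D q (X q) \<xi>) (E1 q)"
    "g q (D q (X q) E2) (\<xi> q) = - g q (D q (X q) \<xi>) (E2 q)"
    "g q (D q (X q) E2) (E1 q) = - g q (D q (X q) E1) (E2 q)"
    "g q (D q (X q) E1) (E1 q) = 0"
    "g q (D q (X q) E2) (E2 q) = 0"
proof -
  have X: "X q \<in> T q" using assms q smooth_vfieldD(1) by blast
  note s = g_sym[OF _ D_in[OF U E1 q X]] g_sym[OF _ D_in[OF U E2 q X]] g_sym[OF _ D_in[OF U xi q X]]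
  show "g q (D q (X q) E1) (\<xi> q) = - g q (D q (X q) \<xi>) (E1 q)"
    using const[OF assms E1 xi null_pairD(11)[OF pair]] s frame by simp
  show "g q (D q (X q) E2) (\<xi> q) = - g q (D q (X q) \<xi>) (E2 q)"
    using const[OF assms E2 xi null_pairD(12)[OF pair]] s frame by simp
  show "g q (D q (X q) E2) (E1 q) = - g q (D q (X q) E1) (E2 q)"
    using const[OF assms E2 E1 null_pairD(6)[OF pair]] s frame by simp
  show "g q (D q (X q) E1) (E1 q) = 0"
    using const[OF assms E1 E1 null_pairD(7)[OF pair]] s frame by simp
  show "g q (D q (X q) E2) (E2 q) = 0"
    using const[OF assms E2 E2 null_pairD(8)[OF pair]] s frame by simp
qed

lemmas swap = g_D_swap[OF E1] g_D_swap[OF E2] g_D_swap[OF xi]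
  g_D_xi_xi[OF U E1 q] g_D_xi_xi[OF U E2 q] g_D_xi_xi[OF U xi q]

text \<open>Both [xi, E1] and [xi, E2] are orthogonal to xi, and skewness moves the derivative along
  xi from the frame field to xi. Hence the integral curves of xi are geodesics.\<close>

lemma xi_xi_components: "g q (D q (\<xi> q) \<xi>) (E1 q) = 0" "g q (D q (\<xi> q) \<xi>) (E2 q) = 0"
proof -
  have "g q (xi_bracket E1 q) (\<xi> q) = 0" "g q (xi_bracket E2 q) (\<xi> q) = 0"
    using E1_xi_bracket E2_xi_bracket by (simp_all add: g_xi)
  then show "g q (D q (\<xi> q) \<xi>) (E1 q) = 0" "g q (D q (\<xi> q) \<xi>) (E2 q) = 0"
    unfolding xi_bracket_def by (simp_all add: g_left D_frame_in swap)
qed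

text \<open>Pair h E1 = \<epsilon> E2 with E1. As phi is skew and fixes E1, the projection (1 -
  phi)/2 disappears and \<epsilon> = g([xi, E1], E1) remains.\<close>

lemma E1_E1_component: "g q (D q (E1 q) \<xi>) (E1 q) = - \<epsilon>"
proof -
  have "h_op A \<phi> \<xi> E1 q = (1 / 2) *\<^sub>T (xi_bracket E1 q - \<phi> q (xi_bracket E1 q))"
    using h_op_eigen[OF U E1 q, of 1] null_pairD(3)[OF pair] by simp
  then have "g q (\<epsilon> *\<^sub>T E2 q) (E1 q) = g q ((1 / 2) *\<^sub>T (xi_bracket E1 q - \<phi> q (xi_bracket E1 q))) (E1 q)"
    using h_E1[OF q] by simp
  then have "\<epsilon> = g q (xi_bracket E1 q) (E1 q)"
    using E1_xi_bracket
    by (simp add: g_left frame tangent_space_closed phi_in g_phi_left)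
  then show ?thesis
    unfolding xi_bracket_def by (simp add: g_left D_frame_in frame swap)
qed

lemma E1_E2_xi_component: "C q = B q + 2"
proof -
  have "g q (D q (E1 q) E2 - D q (E2 q) E1) (\<xi> q) = 2"
    using eta_bracket[OF U E1 E2 q null_pairD(14)[OF pair] null_pairD(15)[OF pair]]
    by (simp add: g_xi D_frame_in tangent_space_closed frame g_right)
  then show ?thesis
    by (simp add: g_left D_frame_in swap B_def C_def)
qed

lemma D_table:
  "D q (\<xi> q) \<xi> = 0"
  "D q (\<xi> q) E1 = m q *\<^sub>T E1 q"
  "D q (\<xi> q) E2 = (- m q) *\<^sub>T E2 q"
  "D q (E1 q) \<xi> = B q *\<^sub>T E1 q - \<epsilon> *\<^sub>T E2 q"
  "D q (E1 q) E1 = b q *\<^sub>T E1 q + \<epsilon> *\<^sub>T \<xi> q"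
  "D q (E1 q) E2 = (- b q) *\<^sub>T E2 q - B q *\<^sub>T \<xi> q"
  "D q (E2 q) \<xi> = K q *\<^sub>T E1 q + C q *\<^sub>T E2 q"
  "D q (E2 q) E1 = b' q *\<^sub>T E1 q - C q *\<^sub>T \<xi> q"
  "D q (E2 q) E2 = (- b' q) *\<^sub>T E2 q - K q *\<^sub>T \<xi> q"
  by (rule null_pair_eqI[OF pair[OF q]];
      simp add: D_frame_in tangent_space_closed g_left frame swap xi_xi_components E1_E1_component
        B_def C_def K_def b_def b'_def m_def)+

text \<open>h E2 comes from the projection onto the +1 eigenspace, which is orthogonal to E1. Thus
  the mu-term drops out of the diagonal component of R(xi, E2)xi.\<close>

lemma h_E2: "g q (h_op A \<phi> \<xi> E2 q) (E1 q) = 0" "h_op A \<phi> \<xi> E2 q \<in> T q"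
proof -
  have "h_op A \<phi> \<xi> E2 q = (1 / 2) *\<^sub>T ((- 1) *\<^sub>T xi_bracket E2 q - \<phi> q (xi_bracket E2 q))"
    by (rule h_op_eigen[OF U E2 q]) (simp add: null_pairD(4)[OF pair])
  then show "g q (h_op A \<phi> \<xi> E2 q) (E1 q) = 0" "h_op A \<phi> \<xi> E2 q \<in> T q"
    using E2_xi_bracket by (simp_all add: g_left g_right frame tangent_space_closed phi_in g_phi_left)
qed

text \<open>The product rule replaces g(D_X D_Y xi, Z) by X g(D_Y xi, Z) - g(D_Y xi, D_X Z). Only
  derivatives of scalar components and entries of \<open>D_table\<close> are then needed.\<close>

lemma g_curvature:
  assumes X: "smooth_vfield A U X" and Y: "smooth_vfield A U Y" and Z: "smooth_vfield A U Z"
  shows "g q (curvature A D X Y \<xi> q) (Z q) =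
    X q (\<lambda>r. g r (D r (Y r) \<xi>) (Z r)) - g q (D q (Y q) \<xi>) (D q (X q) Z)
    - Y q (\<lambda>r. g r (D r (X r) \<xi>) (Z r)) + g q (D q (X q) \<xi>) (D q (Y q) Z)
    - g q (D q (D q (X q) Y - D q (Y q) X) \<xi>) (Z q)"
proof -
  have T: "X q \<in> T q" "Y q \<in> T q" "Z q \<in> T q"
    using X Y Z q smooth_vfieldD(1) by blast+
  note c = cov_smooth[OF U X xi] cov_smooth[OF U Y xi]
  have cov_apply: "cov D X' Y' r = D r (X' r) Y'" for X' Y' r
    by (simp add: cov_def)
  have br: "D q (X q) Y - D q (Y q) X \<in> T q"
    by (intro tangent_space_closed D_in[OF U _ q] X Y T)
  have "curvature A D X Y \<xi> q = D q (X q) (cov D Y \<xi>) - D q (Y q) (cov D X \<xi>)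
      - D q (D q (X q) Y - D q (Y q) X) \<xi>"
    by (simp add: curvature_def cov_apply bracket_eq[OF U X Y q])
  then show ?thesis
    using metric_deriv[OF U X c(2) Z q] metric_deriv[OF U Y c(1) Z q] T br
      D_in[OF U c(1) q] D_in[OF U c(2) q] D_in[OF U xi q]
    by (simp add: g_left tangent_space_closed cov_apply)
qed

lemma curvature_xi:
  assumes X: "smooth_vfield A U X" and "\<eta> q (X q) = 0"
  shows "curvature A D \<xi> X \<xi> q = - (\<kappa> *\<^sub>T X q + \<mu> *\<^sub>T h_op A \<phi> \<xi> X q)"
proof -
  have "curvature A D \<xi> X \<xi> q =
      \<kappa> *\<^sub>T (\<eta> q (X q) *\<^sub>T \<xi> q - \<eta> q (\<xi> q) *\<^sub>T X q)
      + \<mu> *\<^sub>T (\<eta> q (X q) *\<^sub>T h_op A \<phi> \<xi> \<xi> q - \<eta> q (\<xi> q) *\<^sub>T h_op A \<phi> \<xi> X q)"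
    using kappa_mu[unfolded kappa_mu_space_def, THEN spec[where x = U], THEN spec[where x = \<xi>],
        THEN spec[where x = X]] U xi X q by simp
  then show ?thesis
    using assms(2) by (simp add: tscale_def fun_eq_iff)
qed

lemma curvature_E1_E2: "curvature A D E1 E2 \<xi> q = 0"
  using kappa_mu[unfolded kappa_mu_space_def, THEN spec[where x = U], THEN spec[where x = E1],
      THEN spec[where x = E2]] U E1 E2 q frame by simp

end

section \<open>The curvature equations and their solution\<close>

lemma component_deriv_cong:
  assumes q: "q \<in> U" and X: "smooth_vfield A U X" and "\<And>r. r \<in> U \<Longrightarrow> f r = h r"
  shows "X q f = X q h"
  by (rule tangent_vec_cong[OF smooth_vfieldD(1)[OF X q] U q]) (rule assms(3))

lemma const_component_deriv:
  assumes "q \<in> U" "smooth_vfield A U X" "\<And>r. r \<in> U \<Longrightarrow> f r = a"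
  shows "X q f = 0"
  using component_deriv_cong[OF assms(1,2), of f "\<lambda>_. a"] assms(3)
    tangent_vec_const[OF smooth_vfieldD(1)[OF assms(2,1)], of a] by simp

text \<open>Needed for xi(B + 2) = xi(B), since tangent vectors are additive on smooth germs
  only.\<close>

lemma B_smooth: "smooth_fun A U B"
  using g_smooth[OF U cov_smooth[OF U E1 xi] E2] unfolding B_def cov_def by (simp add: B_def[abs_def])

lemmas D_eqs = D_table D_diff[OF U xi] D_add[OF U xi] D_scale[OF U xi]

text \<open>Pairing R(xi, E1)xi with E2 isolates kappa. Pairing it with E1 isolates mu through h E1
  = \<epsilon> E2, and this equation is algebraic because g(D_E1 xi, E1) is the constant -
  \<epsilon>.\<close>

lemma xi_E1_equations:
  assumes q: "q \<in> U"
  shows "\<xi> q B + B q * B q - \<epsilon> * K q = - \<kappa>" "2 * m q - (B q + C q) = - \<mu>"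
proof -
  \<comment> \<open>The derivative of xi along itself vanishes on all of \<open>U\<close>, so its
    components have derivative 0.\<close>
  have 0: "E1 q (\<lambda>r. g r (D r (\<xi> r) \<xi>) (Z r)) = 0" if "smooth_vfield A U Z" for Z
    by (rule const_component_deriv[OF q E1]) (simp add: D_table g_left(5) smooth_vfieldD(1)[OF that])
  have A: "\<xi> q (\<lambda>r. g r (D r (E1 r) \<xi>) (E1 r)) = 0"
    by (rule const_component_deriv[OF q xi]) (simp add: E1_E1_component)
  have c: "curvature A D \<xi> E1 \<xi> q = - (\<kappa> *\<^sub>T E1 q + (\<mu> * \<epsilon>) *\<^sub>T E2 q)"
    unfolding curvature_xi[OF q E1 frame(14)[OF q]] h_E1[OF q]
    by (simp add: tscale_def mult.assoc)
  have "g q (curvature A D \<xi> E1 \<xi> q) (E2 q) = - \<kappa>" "g q (curvature A D \<xi> E1 \<xi> q) (E1 q) = - (\<mu> * \<epsilon>)"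
    unfolding c by (simp_all add: g_left tangent_space_closed frame[OF q])
  then show "\<xi> q B + B q * B q - \<epsilon> * K q = - \<kappa>" 
    unfolding g_curvature[OF q xi E1 E2] g_curvature[OF q xi E1 E1] 0[OF E1] 0[OF E2] A B_def[symmetric, abs_def]
    by (simp_all add: D_eqs q g_left g_right tangent_space_closed frame[OF q] algebra_simps)
  have "\<epsilon> * (2 * m q - (B q + C q)) = - \<epsilon> * \<mu>"
    using \<open>g q (curvature A D \<xi> E1 \<xi> q) (E1 q) = - (\<mu> * \<epsilon>)\<close>
    unfolding g_curvature[OF q xi E1 E1] 0[OF E1] A
    by (simp add: D_eqs q g_left g_right tangent_space_closed frame[OF q] algebra_simps)
  then show "2 * m q - (B q + C q) = - \<mu>"
    using eps by (metis mult_cancel_left mult_minus_left mult_minus_right mult_zero_left zero_neq_one)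
qed

lemma xi_E2_equation:
  assumes q: "q \<in> U"
  shows "\<xi> q C + C q * C q - \<epsilon> * K q = - \<kappa>"
proof -
  have 0: "E2 q (\<lambda>r. g r (D r (\<xi> r) \<xi>) (E1 r)) = 0"
    by (rule const_component_deriv[OF q E2]) (simp add: D_table g_left(5) smooth_vfieldD(1)[OF E1])
  have "g q (curvature A D \<xi> E2 \<xi> q) (E1 q) = - \<kappa>"
    unfolding curvature_xi[OF q E2 frame(15)[OF q]]
    by (simp add: g_left tangent_space_closed frame[OF q] h_E2[OF q])
  then show ?thesis
    unfolding g_curvature[OF q xi E2 E1] 0 C_def[symmetric, abs_def]
    by (simp add: D_eqs q g_left g_right tangent_space_closed frame[OF q] algebra_simps)
qed

text \<open>Subtracting the two diagonal equations cancels kappa, K and the derivatives; (B + 2)^2 =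
  B^2 has the single root -1.\<close>

lemma B_eq: "q \<in> U \<Longrightarrow> B q = - 1" and C_eq: "q \<in> U \<Longrightarrow> C q = 1"
proof -
  assume q: "q \<in> U"
  have "\<xi> q C = \<xi> q (\<lambda>r. B r + 2)"
    by (rule component_deriv_cong[OF q xi E1_E2_xi_component])
  also have "\<dots> = \<xi> q B"
    using tangent_vec_add[OF xi_in smooth_nearI[OF U q B_smooth] smooth_nearI[OF U q smooth_fun_const]]
      tangent_vec_const[OF xi_in] by simp
  finally have "B q * B q = C q * C q"
    using xi_E1_equations(1)[OF q] xi_E2_equation[OF q] by simp
  then show "B q = - 1" "C q = 1"
    unfolding E1_E2_xi_component[OF q] by (simp_all add: algebra_simps)
qed

lemma m_eq: "q \<in> U \<Longrightarrow> m q = - \<mu> / 2"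
  using xi_E1_equations(2)[of q] B_eq[of q] C_eq[of q] by simp

lemma K_eq:
  assumes q: "q \<in> U"
  shows "K q = \<epsilon> * (\<kappa> + 1)"
proof -
  have "\<xi> q B = 0"
    by (rule const_component_deriv[OF q xi B_eq])
  then have "\<epsilon> * K q = \<kappa> + 1"
    using xi_E1_equations(1)[OF q] B_eq[OF q] by simp
  then show ?thesis
    using eps by (metis mult.assoc mult_1)
qed

text \<open>The component of R(E1, E2)xi = 0 paired with E1 reads -2 \<epsilon> b' = 0, the one
  paired with E2 reads 2 K b = 0.\<close>

lemma b'_eq: "q \<in> U \<Longrightarrow> b' q = 0" and b_eq: "q \<in> U \<Longrightarrow> (\<kappa> + 1) * b q = 0"
proof -
  assume q: "q \<in> U"
  \<comment> \<open>By now these four components of the derivatives of xi are the constants C = 1,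
    K, - \<epsilon> and B = -1.\<close>
  have 0: "E1 q (\<lambda>r. g r (D r (E2 r) \<xi>) (E1 r)) = 0" "E1 q (\<lambda>r. g r (D r (E2 r) \<xi>) (E2 r)) = 0"
      "E2 q (\<lambda>r. g r (D r (E1 r) \<xi>) (E1 r)) = 0" "E2 q (\<lambda>r. g r (D r (E1 r) \<xi>) (E2 r)) = 0"
    by (rule const_component_deriv[OF q E1], erule C_eq[unfolded C_def],
        rule const_component_deriv[OF q E1], erule K_eq[unfolded K_def],
        rule const_component_deriv[OF q E2], erule E1_E1_component,
        rule const_component_deriv[OF q E2], erule B_eq[unfolded B_def])
  have "g q (curvature A D E1 E2 \<xi> q) (Z q) = 0" if "smooth_vfield A U Z" for Z
    using smooth_vfieldD(1)[OF that q] by (simp add: curvature_E1_E2[OF q] g_left)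
  note R = this[OF E1] this[OF E2]
  have br: "D q (E1 q) E2 - D q (E2 q) E1 = (- b q) *\<^sub>T E2 q - b' q *\<^sub>T E1 q + 2 *\<^sub>T \<xi> q"
    unfolding D_table[OF q] B_eq[OF q] C_eq[OF q] by (simp add: tscale_def fun_eq_iff)
  from R have "\<epsilon> * b' q = 0" "\<epsilon> * ((\<kappa> + 1) * b q) = 0"
    unfolding g_curvature[OF q E1 E2 E1] g_curvature[OF q E1 E2 E2] 0 br
    by (simp_all add: D_eqs q B_eq C_eq K_eq g_left g_right tangent_space_closed frame[OF q])
  then show "b' q = 0" "(\<kappa> + 1) * b q = 0"
    using eps by auto
qed

lemma b_smooth: "smooth_fun A U b"
  using g_smooth[OF U cov_smooth[OF U E1 E1] E2] unfolding cov_def by (simp add: b_def[abs_def])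

end

theorem proposition9:
  fixes A :: "'m::{t2_space, second_countable_topology} atlas"
    and \<phi> :: "'m tensor11" and \<xi> :: "'m vfield" and \<eta> :: "'m form1" and g :: "'m bilin"
    and D :: "'m conn" and \<kappa> \<mu> :: real
    and p :: 'm and W :: "'m set" and X :: "'m vfield"
  assumes manifold: "smooth_atlas A" "connected (UNIV :: 'm set)"
    and paracontact: "paracontact_metric A \<phi> \<xi> \<eta> g"
    and not_para_sasakian: "\<not> para_sasakian A \<phi> \<xi> \<eta> g"
    and levi_civita: "levi_civita A g D"
    and kappa_mu: "kappa_mu_space A \<phi> \<xi> \<eta> D \<kappa> \<mu>"
    and W: "open W" "p \<in> W"
    and X: "smooth_vfield A W X" "\<forall>q\<in>W. \<phi> q (X q) = X q" "\<forall>q\<in>W. h_op A \<phi> \<xi> X q \<noteq> 0"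
  shows "\<exists>U E1 E2 b \<epsilon>.
    open U \<and> p \<in> U \<and> artin_frame A \<phi> \<xi> g U E1 E2 \<and> smooth_fun A U b \<and> \<epsilon> \<in> {1, - 1 :: real} \<and>
    (\<forall>q\<in>U.
      cov D \<xi> \<xi> q = 0 \<and>
      cov D \<xi> E1 q = (- \<mu> / 2) *\<^sub>T E1 q \<and>
      cov D \<xi> E2 q = (\<mu> / 2) *\<^sub>T E2 q \<and>
      cov D E1 \<xi> q = - E1 q - \<epsilon> *\<^sub>T E2 q \<and>
      cov D E1 E1 q = b q *\<^sub>T E1 q + \<epsilon> *\<^sub>T \<xi> q \<and>
      cov D E1 E2 q = (- b q) *\<^sub>T E2 q + \<xi> q \<and>
      cov D E2 \<xi> q = (\<epsilon> * (\<kappa> + 1)) *\<^sub>T E1 q + E2 q \<and>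
      cov D E2 E1 q = - \<xi> q \<and>
      cov D E2 E2 q = (- \<epsilon> * (\<kappa> + 1)) *\<^sub>T \<xi> q) \<and>
    (\<kappa> \<noteq> - 1 \<longrightarrow> (\<forall>q\<in>U. b q = 0))"
proof -
  interpret paracontact_manifold A \<phi> \<xi> \<eta> g D
    by unfold_locales (fact manifold paracontact levi_civita)+
  obtain U E1 E2 and \<epsilon> :: real where U: "open U" "p \<in> U" "\<epsilon> \<in> {1, - 1}"
    and E: "smooth_vfield A U E1" "smooth_vfield A U E2"
    "\<And>r. r \<in> U \<Longrightarrow> null_pair r (E1 r) (E2 r)"
    "\<And>r. r \<in> U \<Longrightarrow> h_op A \<phi> \<xi> E1 r = \<epsilon> *\<^sub>T E2 r"
    using h_adapted_frame_exists[OF W X(1) X(2)[rule_format] X(3)[rule_format]] by metis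
  interpret F: h_adapted_frame A \<phi> \<xi> \<eta> g D U E1 E2 \<epsilon> \<kappa> \<mu>
    by unfold_locales (use kappa_mu U E in auto)
  have "artin_frame A \<phi> \<xi> g U E1 E2"
    unfolding artin_frame_def using E null_pair_tangent_basis[OF E(3)] null_pairD[OF E(3)] by simp
  moreover have "cov D \<xi> \<xi> q = 0 \<and>
      cov D \<xi> E1 q = (- \<mu> / 2) *\<^sub>T E1 q \<and>
      cov D \<xi> E2 q = (\<mu> / 2) *\<^sub>T E2 q \<and>
      cov D E1 \<xi> q = - E1 q - \<epsilon> *\<^sub>T E2 q \<and>
      cov D E1 E1 q = F.b q *\<^sub>T E1 q + \<epsilon> *\<^sub>T \<xi> q \<and>
      cov D E1 E2 q = (- F.b q) *\<^sub>T E2 q + \<xi> q \<and>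
      cov D E2 \<xi> q = (\<epsilon> * (\<kappa> + 1)) *\<^sub>T E1 q + E2 q \<and>
      cov D E2 E1 q = - \<xi> q \<and>
      cov D E2 E2 q = (- \<epsilon> * (\<kappa> + 1)) *\<^sub>T \<xi> q" if "q \<in> U" for q
    unfolding cov_def F.D_table[OF that] F.m_eq[OF that] F.B_eq[OF that] F.C_eq[OF that]
      F.K_eq[OF that] F.b'_eq[OF that]
    by (simp add: tscale_def fun_eq_iff)
  moreover have "F.b q = 0" if "q \<in> U" "\<kappa> \<noteq> - 1" for q
    using F.b_eq[OF that(1)] that(2) by auto
  ultimately show ?thesis
    using U F.b_smooth by blast
qed

end
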